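(* Let $S$ be a cancellative and right amenable monoid, $X$ a (discrete) Abelian group, $\lambda$ a left $S$-action on $X$ by endomorphisms, and $Y$ an $S$-invariant subgroup of $X$. Then $$h_{\mathrm{alg}}(\lambda)=h_{\mathrm{alg}}(\lambda_Y)+h_{\mathrm{alg}}(\lambda_{X/Y}),$$ where $\lambda_Y$ and $\lambda_{X/Y}$ are the left $S$-actions induced by $\lambda$ on $Y$ and on $X/Y$, respectively.
   Context: A cancellative monoid $S$ is right amenable if it admits a right F{\o}lner net, i.e. a net $\{F_i\}_{i\in I}$ of non-empty finite subsets of $S$ such that $\lim_{i\in I}|F_is\setminus F_i|/|F_i|=0$ for every $s\in S$. A left $S$-action $\lambda$ on an Abelian group $X$ is a family of endomorphisms $\lambda_s$ ($s\in S$) of $X$ with $\lambda_1=\mathrm{id}_X$ and $\lambda_{st}=\lambda_s\circ\lambda_t$. A subgroup $Y\le X$ is $S$-invariant if $\lambda_s(Y)\subseteq Y$ for all $s\in S$; then $(\lambda_Y)_s=\lambda_s|_Y$ and $(\lambda_{X/Y})_s(x+Y)=\lambda_s(x)+Y$. Algebraic entropy: for a finite subset $E\subseteq X$ containing $0$ and a non-empty finite $F\subseteq S$ let $T_F(\lambda,E)=\sum_{s\in F}\lambda_s(E)$ (sum of subsets of $X$). For a right F{\o}lner net $\{F_i\}_{i\in I}$ of $S$ put $H_{\mathrm{alg}}(\lambda,E)=\lim_{i\in I}\frac{\log|T_{F_i}(\lambda,E)|}{|F_i|}$ (the limit exists and does not depend on the net), and $h_{\mathrm{alg}}(\lambda)=\sup_E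 H_{\mathrm{alg}}(\lambda,E)\in[0,\infty]$, the supremum being over all finite $E\subseteq X$ with $0\in E$. *)

theory Defs
  imports
    "HOL-Analysis.Analysis"
    "HOL-Algebra.Divisibility"
    "HOL-Algebra.Coset"
    "HOL-Algebra.FiniteProduct"
begin

section \<open>Nets\<close>

definition directed_set :: "'i set \<Rightarrow> ('i \<Rightarrow> 'i \<Rightarrow> bool) \<Rightarrow> bool" where
  "directed_set I leq \<longleftrightarrow>
     I \<noteq> {} \<and>
     (\<forall>i\<in>I. leq i i) \<and>
     (\<forall>i\<in>I. \<forall>j\<in>I. \<forall>k\<in>I. leq i j \<longrightarrow> leq j k \<longrightarrow> leq i k) \<and>
     (\<forall>i\<in>I. \<forall>j\<in>I. \<exists>k\<in>I. leq i k \<and> leq j k)"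

definition net_filter :: "'i set \<Rightarrow> ('i \<Rightarrow> 'i \<Rightarrow> bool) \<Rightarrow> 'i filter" where
  "net_filter I leq = (INF i\<in>I. principal {j \<in> I. leq i j})"

lemma eventually_net_filter:
  assumes "directed_set I leq"
  shows "eventually P (net_filter I leq) \<longleftrightarrow> (\<exists>i\<in>I. \<forall>j\<in>I. leq i j \<longrightarrow> P j)"
proof -
  have "\<exists>x\<in>I. principal {j \<in> I. leq x j} \<le> inf (principal {j \<in> I. leq a j}) (principal {j \<in> I. leq b j})"
    if ab: "a \<in> I" "b \<in> I" for a b
  proof -
    obtain k where "k \<in> I" "leq a k" "leq b k"
      using assms ab unfolding directed_set_def by meson
    moreover from this have "{j \<in> I. leq k j} \<subseteq> {j \<in> I. leq a j} \<inter> {j \<in> I. leq b j}"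
      using assms ab unfolding directed_set_def by blast
    ultimately show ?thesis by auto
  qed
  moreover have "I \<noteq> {}" using assms unfolding directed_set_def by blast
  ultimately show ?thesis
    unfolding net_filter_def
    by (subst eventually_INF_base) (auto simp: eventually_principal)
qed


section \<open>Right amenability\<close>

definition right_folner_net ::
  "('s, 'm) monoid_scheme \<Rightarrow> 'i set \<Rightarrow> ('i \<Rightarrow> 'i \<Rightarrow> bool) \<Rightarrow> ('i \<Rightarrow> 's set) \<Rightarrow> bool" where
  "right_folner_net S I leq F \<longleftrightarrow>
     directed_set I leq \<and>
     (\<forall>i\<in>I. F i \<subseteq> carrier S \<and> finite (F i) \<and> F i \<noteq> {}) \<and>
     (\<forall>s\<in>carrier S.
        ((\<lambda>i. real (card ((F i #>\<^bsub>S\<^esub> s) - F i)) / real (card (F i))) \<longlongrightarrow> 0) (net_filter I leq))"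

text \<open>
  A definition cannot quantify over all index types.  Nets of subsets of a type \<open>'s\<close> are
  therefore indexed by sets of pairs (tail, element of the tail); by the lemma
  \<open>folner_net_reindex\<close> below this loses nothing, as a net over any index type has the same
  limits as one of this form.
\<close>

type_synonym 's net_index = "'s set set \<times> 's set"

definition right_amenable :: "('s, 'm) monoid_scheme \<Rightarrow> bool" where
  "right_amenable S \<longleftrightarrow>
     (\<exists>(I :: 's net_index set) leq F. right_folner_net S I leq F)"

lemma net_reindex:
  fixes F :: "'i \<Rightarrow> 's set"
  assumes I: "directed_set I leq"
  obtains J :: "'s net_index set" and leq' F'
  where "directed_set J leq'" "F' ` J = F ` I"
    "filtermap F' (net_filter J leq') = filtermap F (net_filter I leq)"
proof -
  define T where "T i = F ` {j \<in> I. leq i j}" for i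
  define J :: "'s net_index set" where "J = (\<Union>i\<in>I. {T i} \<times> T i)"
  define leq' :: "'s net_index \<Rightarrow> 's net_index \<Rightarrow> bool" where "leq' p q \<longleftrightarrow> fst q \<subseteq> fst p" for p q
  have rfl: "leq i i" if "i \<in> I" for i
    using I that unfolding directed_set_def by blast
  have trn: "leq i k" if "i \<in> I" "j \<in> I" "k \<in> I" "leq i j" "leq j k" for i j k
    using I that unfolding directed_set_def by blast
  have T_mono: "T j \<subseteq> T i" if "i \<in> I" "j \<in> I" "leq i j" for i j
    using trn that unfolding T_def by blast
  have T_self: "F i \<in> T i" if "i \<in> I" for i
    using rfl that unfolding T_def by blast
  have J: "directed_set J leq'"
    unfolding directed_set_def
  proof (intro conjI ballI impI)
    show "J \<noteq> {}" using I T_self unfolding directed_set_def J_def by blast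
    fix p q assume "p \<in> J" "q \<in> J"
    then obtain i j where ij: "i \<in> I" "j \<in> I" "fst p = T i" "fst q = T j"
      unfolding J_def by auto
    obtain k where k: "k \<in> I" "leq i k" "leq j k"
      using I ij unfolding directed_set_def by meson
    have "(T k, F k) \<in> J" using k T_self unfolding J_def by blast
    moreover have "leq' p (T k, F k)" "leq' q (T k, F k)"
      using T_mono k ij unfolding leq'_def by simp_all
    ultimately show "\<exists>r\<in>J. leq' p r \<and> leq' q r" by blast
  qed (auto simp: leq'_def)
  have "snd ` J = F ` I"
  proof
    show "snd ` J \<subseteq> F ` I" unfolding J_def T_def by auto
    show "F ` I \<subseteq> snd ` J"
    proof
      fix A assume "A \<in> F ` I"
      then obtain i where "i \<in> I" "A = F i" by blast
      then have "(T i, A) \<in> J" using T_self unfolding J_def by blast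
      then show "A \<in> snd ` J" by force
    qed
  qed
  moreover have "filtermap snd (net_filter J leq') = filtermap F (net_filter I leq)"
  proof (rule filter_eqI)
    fix P :: "'s set \<Rightarrow> bool"
    have "(\<exists>p\<in>J. \<forall>q\<in>J. leq' p q \<longrightarrow> P (snd q)) \<longleftrightarrow> (\<exists>i\<in>I. \<forall>j\<in>I. leq i j \<longrightarrow> P (F j))"
      (is "?L \<longleftrightarrow> ?R")
    proof
      assume ?L
      then obtain p where p: "p \<in> J" "\<And>q. q \<in> J \<Longrightarrow> leq' p q \<Longrightarrow> P (snd q)" by blast
      then obtain i where i: "i \<in> I" "fst p = T i" unfolding J_def by auto
      have "P (F j)" if "j \<in> I" "leq i j" for j
      proof -
        have "(T j, F j) \<in> J" using that T_self unfolding J_def by blast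
        moreover have "leq' p (T j, F j)" using T_mono i that unfolding leq'_def by simp
        ultimately show ?thesis using p(2) by fastforce
      qed
      then show ?R using i by blast
    next
      assume ?R
      then obtain i where i: "i \<in> I" "\<And>j. j \<in> I \<Longrightarrow> leq i j \<Longrightarrow> P (F j)" by blast
      have "P (snd q)" if "q \<in> J" "leq' (T i, F i) q" for q
      proof -
        have "snd q \<in> T i" using that unfolding J_def leq'_def by auto
        then show ?thesis using i unfolding T_def by auto
      qed
      moreover have "(T i, F i) \<in> J" using i T_self unfolding J_def by blast
      ultimately show ?L by blast
    qed
    then show "eventually P (filtermap snd (net_filter J leq')) =
      eventually P (filtermap F (net_filter I leq))"
      by (simp add: eventually_filtermap eventually_net_filter[OF I] eventually_net_filter[OF J])
  qed
  ultimately show ?thesis using J that by blast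
qed

lemma folner_net_reindex:
  assumes F: "right_folner_net S I leq F"
  obtains J :: "'s net_index set" and leq' and F' :: "'s net_index \<Rightarrow> 's set"
  where "right_folner_net S J leq' F'"
    "\<And>(g :: 's set \<Rightarrow> real) l. ((\<lambda>j. g (F' j)) \<longlongrightarrow> l) (net_filter J leq') \<longleftrightarrow>
       ((\<lambda>i. g (F i)) \<longlongrightarrow> l) (net_filter I leq)"
proof -
  have "directed_set I leq" using F unfolding right_folner_net_def by blast
  from net_reindex[OF this, where F = F]
  obtain J :: "'s net_index set" and leq' F' where
    J: "directed_set J leq'" "F' ` J = F ` I"
      "filtermap F' (net_filter J leq') = filtermap F (net_filter I leq)" by blast
  have lim: "((\<lambda>j. g (F' j)) \<longlongrightarrow> l) (net_filter J leq') \<longleftrightarrow>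
       ((\<lambda>i. g (F i)) \<longlongrightarrow> l) (net_filter I leq)" for g :: "'s set \<Rightarrow> real" and l
    using filterlim_filtermap[of g "nhds l" F' "net_filter J leq'"]
      filterlim_filtermap[of g "nhds l" F "net_filter I leq"] J(3) by simp
  have vals: "F' j \<subseteq> carrier S \<and> finite (F' j) \<and> F' j \<noteq> {}" if j: "j \<in> J" for j
  proof -
    obtain i where "i \<in> I" "F' j = F i" using J(2) j by blast
    then show ?thesis using F unfolding right_folner_net_def by simp
  qed
  have "((\<lambda>j. real (card ((F' j #>\<^bsub>S\<^esub> s) - F' j)) / real (card (F' j))) \<longlongrightarrow> 0)
      (net_filter J leq')" if s: "s \<in> carrier S" for s
    using lim[of "\<lambda>A. real (card ((A #>\<^bsub>S\<^esub> s) - A)) / real (card A)" 0] F s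
    unfolding right_folner_net_def by simp
  then have "right_folner_net S J leq' F'"
    using J(1) vals unfolding right_folner_net_def by blast
  then show ?thesis using lim that by blast
qed


section \<open>Actions and induced actions\<close>

text \<open>Abelian groups are written multiplicatively, following the group library.\<close>

definition left_action ::
  "('s, 'm) monoid_scheme \<Rightarrow> ('a, 'b) monoid_scheme \<Rightarrow> ('s \<Rightarrow> 'a \<Rightarrow> 'a) \<Rightarrow> bool" where
  "left_action S X lam \<longleftrightarrow>
     (\<forall>s\<in>carrier S. lam s \<in> hom X X) \<and>
     (\<forall>x\<in>carrier X. lam \<one>\<^bsub>S\<^esub> x = x) \<and>
     (\<forall>s\<in>carrier S. \<forall>t\<in>carrier S. \<forall>x\<in>carrier X. lam (s \<otimes>\<^bsub>S\<^esub> t) x = lam s (lam t x))"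

definition invariant_subgroup ::
  "('s, 'm) monoid_scheme \<Rightarrow> ('a, 'b) monoid_scheme \<Rightarrow> ('s \<Rightarrow> 'a \<Rightarrow> 'a) \<Rightarrow> 'a set \<Rightarrow> bool" where
  "invariant_subgroup S X lam Y \<longleftrightarrow>
     subgroup Y X \<and> (\<forall>s\<in>carrier S. lam s ` Y \<subseteq> Y)"

definition sub_action :: "('s \<Rightarrow> 'a \<Rightarrow> 'a) \<Rightarrow> 'a set \<Rightarrow> 's \<Rightarrow> 'a \<Rightarrow> 'a" where
  "sub_action lam Y s = restrict (lam s) Y"

text \<open>
  The cosets \<open>lam s x Y\<close>, for \<open>x\<close> in a given coset of \<open>Y\<close>, all coincide, so their union is that
  coset; see \<open>quotient_action_coset\<close>.
\<close>

definition quotient_action ::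
  "('a, 'b) monoid_scheme \<Rightarrow> ('s \<Rightarrow> 'a \<Rightarrow> 'a) \<Rightarrow> 'a set \<Rightarrow> 's \<Rightarrow> 'a set \<Rightarrow> 'a set" where
  "quotient_action X lam Y s C = (\<Union>x\<in>C. Y #>\<^bsub>X\<^esub> lam s x)"

lemma quotient_action_coset:
  assumes X: "comm_group X" and lam: "left_action S X lam" and Y: "invariant_subgroup S X lam Y"
    and s: "s \<in> carrier S" and x: "x \<in> carrier X"
  shows "quotient_action X lam Y s (Y #>\<^bsub>X\<^esub> x) = Y #>\<^bsub>X\<^esub> lam s x"
proof -
  interpret comm_group X by (rule X)
  have sub: "subgroup Y X" and inv: "\<And>y. y \<in> Y \<Longrightarrow> lam s y \<in> Y"
    using Y s unfolding invariant_subgroup_def by auto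
  have hom: "lam s \<in> hom X X" using lam s unfolding left_action_def by blast
  have Yc: "Y \<subseteq> carrier X" using sub by (rule subgroup.subset)
  have "Y #>\<^bsub>X\<^esub> lam s z = Y #>\<^bsub>X\<^esub> lam s x" if z: "z \<in> Y #>\<^bsub>X\<^esub> x" for z
  proof -
    obtain y where y: "y \<in> Y" "z = y \<otimes>\<^bsub>X\<^esub> x" using z unfolding r_coset_def by blast
    then have "lam s z = lam s y \<otimes>\<^bsub>X\<^esub> lam s x"
      using hom x Yc by (auto simp: hom_def)
    then have "lam s z \<in> Y #>\<^bsub>X\<^esub> lam s x"
      using inv[OF y(1)] unfolding r_coset_def by blast
    moreover have "lam s x \<in> carrier X" using hom x by (auto simp: hom_def)
    ultimately show ?thesis using repr_independence sub by metis
  qed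
  moreover have "x \<in> Y #>\<^bsub>X\<^esub> x" using x sub by (rule rcos_self)
  ultimately show ?thesis unfolding quotient_action_def by blast
qed


section \<open>Algebraic entropy\<close>

definition trajectory ::
  "('a, 'b) monoid_scheme \<Rightarrow> ('s \<Rightarrow> 'a \<Rightarrow> 'a) \<Rightarrow> 's set \<Rightarrow> 'a set \<Rightarrow> 'a set" where
  "trajectory X lam F E = {finprod X f F |f. \<forall>s\<in>F. f s \<in> lam s ` E}"

definition H_alg ::
  "('s, 'm) monoid_scheme \<Rightarrow> ('a, 'b) monoid_scheme \<Rightarrow> ('s \<Rightarrow> 'a \<Rightarrow> 'a) \<Rightarrow> 'a set \<Rightarrow> real" where
  "H_alg S X lam E =
     (THE L. \<forall>(I :: 's net_index set) leq F. right_folner_net S I leq F \<longrightarrow>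
        ((\<lambda>i. ln (real (card (trajectory X lam (F i) E))) / real (card (F i))) \<longlongrightarrow> L)
          (net_filter I leq))"

definition h_alg ::
  "('s, 'm) monoid_scheme \<Rightarrow> ('a, 'b) monoid_scheme \<Rightarrow> ('s \<Rightarrow> 'a \<Rightarrow> 'a) \<Rightarrow> ereal" where
  "h_alg S X lam =
     (SUP E\<in>{E. finite E \<and> E \<subseteq> carrier X \<and> \<one>\<^bsub>X\<^esub> \<in> E}. ereal (H_alg S X lam E))"

end

theory Submission
  imports Defs
begin

text \<open>
  Almost all of a sufficiently invariant finite set \<open>F\<close> can be covered by almost disjoint left
  translates \<open>cK\<close> of finitely many tiles \<open>K\<close>, which may be chosen from any family
  containing arbitrarily invariant sets (Ornstein--Weiss).  Here \<open>T\<^sub>c\<^sub>K(E)\<close> is the image of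
  \<open>T\<^sub>K(E)\<close> under \<open>\<lambda>\<^sub>c\<close>, so trajectories along \<open>F\<close> are controlled by those along the tiles.

  For the upper bound take tiles on which \<open>T\<^sub>K(E)\<close> has the expected number of classes modulo \<open>Y\<close>, and write
  \<open>T\<^sub>K(E) \<subseteq> A\<^sub>K + B\<^sub>K\<close> with \<open>A\<^sub>K\<close> a set of representatives of those classes and
  \<open>B\<^sub>K \<subseteq> Y\<close> finite.  The translates of the \<open>A\<^sub>K\<close> contribute the entropy of the quotient,
  and those of the \<open>B\<^sub>K\<close>, whatever the translates are, all lie in \<open>T\<^sub>F(C)\<close> for the single
  finite set \<open>C = \<Sum>\<^sub>K B\<^sub>K \<subseteq> Y\<close>, so they contribute at most the entropy of the subgroup.  With \<open>Y\<close> trivial the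
  same estimate gives the existence of the limits.  The lower bound holds since every fibre of
  \<open>T\<^sub>F(A + B)\<close> over the quotient, for \<open>A \<subseteq> Y\<close>, contains a translate of \<open>T\<^sub>F(A)\<close>.
\<close>

section \<open>The filter of invariant sets\<close>

lemma net_filter_not_bot: "directed_set I leq \<Longrightarrow> net_filter I leq \<noteq> bot"
proof
  assume I: "directed_set I leq" and "net_filter I leq = bot"
  then have "eventually (\<lambda>_. False) (net_filter I leq)" by simp
  moreover have "I \<noteq> {}" using I unfolding directed_set_def by (rule conjunct1)
  moreover have "\<forall>i\<in>I. leq i i" using I unfolding directed_set_def by (elim conjE)
  ultimately show False unfolding eventually_net_filter[OF I] by blast
qed

context monoid_cancel
begin

definition nearly_invariant :: "'a set \<Rightarrow> real \<Rightarrow> 'a set \<Rightarrow> bool" where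
  "nearly_invariant L d K \<longleftrightarrow> finite K \<and> K \<noteq> {} \<and> K \<subseteq> carrier G \<and>
     (\<forall>l\<in>L. real (card ((K #> l) - K)) \<le> d * real (card K))"

text \<open>Every right Folner net converges to this filter, whatever its index type, so a limit
  along it is a limit along all these nets at once.\<close>

definition folner_filter :: "'a set filter" where
  "folner_filter = (INF (L, d)\<in>{L. finite L \<and> L \<subseteq> carrier G} \<times> {0<..}. principal {K. nearly_invariant L d K})"

lemma nearly_invariant_mono:
  "nearly_invariant L d K \<Longrightarrow> L' \<subseteq> L \<Longrightarrow> d \<le> d' \<Longrightarrow> nearly_invariant L' d' K"
  unfolding nearly_invariant_def
  by (meson mult_right_mono of_nat_0_le_iff order_trans subsetD)

lemma eventually_folner_filter:
  "eventually P folner_filter \<longleftrightarrow>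
     (\<exists>L d. finite L \<and> L \<subseteq> carrier G \<and> d > 0 \<and> (\<forall>K. nearly_invariant L d K \<longrightarrow> P K))"
proof -
  let ?B = "{L. finite L \<and> L \<subseteq> carrier G} \<times> {0::real<..}"
  let ?F = "\<lambda>(L, d). principal {K. nearly_invariant L d K}"
  have dir: "\<exists>x\<in>?B. ?F x \<le> inf (?F p) (?F q)" if "p \<in> ?B" "q \<in> ?B" for p q
    using that
    by (intro bexI[of _ "(fst p \<union> fst q, min (snd p) (snd q))"])
       (auto simp: case_prod_beta elim!: nearly_invariant_mono)
  have ne: "?B \<noteq> {}" by (auto intro!: exI[of _ "{}"] exI[of _ 1])
  show ?thesis unfolding folner_filter_def
    by (subst eventually_INF_base[OF ne dir]) (auto simp: eventually_principal)
qed

lemma eventually_nearly_invariant: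
  "finite L \<Longrightarrow> L \<subseteq> carrier G \<Longrightarrow> d > 0 \<Longrightarrow> eventually (nearly_invariant L d) folner_filter"
  unfolding eventually_folner_filter by blast

text \<open>A basic condition \<open>nearly_invariant L d\<close> involves only finitely many of the
  limits that define a right Folner net, so from some index on they are all below \<open>d\<close>
  together.\<close>

lemma folner_net_tendsto_folner_filter:
  assumes F: "right_folner_net G I leq F"
  shows "filterlim F folner_filter (net_filter I leq)"
proof -
  have "eventually (\<lambda>i. nearly_invariant L d (F i)) (net_filter I leq)"
    if L: "finite L" "L \<subseteq> carrier G" "d > 0" for L d
  proof -
    have I: "directed_set I leq" using F unfolding right_folner_net_def by blast
    then have "I \<noteq> {}" unfolding directed_set_def by (rule conjunct1)
    \<comment> \<open>Nothing is known about \<open>F\<close> off the index set, so membership in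
      \<open>I\<close> is carried along as an eventual property.\<close>
    then have inI: "eventually (\<lambda>i. i \<in> I) (net_filter I leq)"
      unfolding eventually_net_filter[OF I] by auto
    have "eventually (\<lambda>i. \<forall>l\<in>L. card ((F i #> l) - F i) / card (F i) < d) (net_filter I leq)"
      using L F unfolding right_folner_net_def
      by (intro eventually_ball_finite) (auto intro: order_tendstoD(2))
    with inI show ?thesis
    proof eventually_elim
      case (elim i)
      then have Fi: "finite (F i)" "F i \<noteq> {}" "F i \<subseteq> carrier G"
        using F unfolding right_folner_net_def by auto
      then have "card (F i) > 0" by (simp add: card_gt_0_iff)
      with elim Fi show ?case
        unfolding nearly_invariant_def by (auto simp: divide_less_eq intro: less_imp_le)
    qed
  qed
  then show ?thesis
    unfolding filterlim_iff eventually_folner_filter by (blast intro: eventually_mono)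
qed

text \<open>The tail filter of a Folner net is proper and its image lies below
  \<open>folner_filter\<close>. Properness is what turns \<open>eventually\<close> into
  \<open>frequently\<close> and allows inequalities to pass to limits.\<close>

lemma folner_filter_not_bot:
  assumes "right_amenable G"
  shows "folner_filter \<noteq> bot"
proof
  assume "folner_filter = bot"
  moreover obtain I :: "'a net_index set" and leq F where F: "right_folner_net G I leq F"
    using assms unfolding right_amenable_def by blast
  moreover have "net_filter I leq \<noteq> bot"
    using F unfolding right_folner_net_def by (intro net_filter_not_bot) simp
  ultimately show False
    using folner_net_tendsto_folner_filter[OF F] by (simp add: filterlim_def bot_unique filtermap_bot_iff)
qed

lemma eventually_finite_folner_filter:
  "eventually (\<lambda>A. finite A \<and> A \<noteq> {} \<and> A \<subseteq> carrier G) folner_filter"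
  using eventually_nearly_invariant[of "{}" 1] unfolding nearly_invariant_def by simp

section \<open>Quasi-tilings\<close>

lemma card_r_coset: "A \<subseteq> carrier G \<Longrightarrow> x \<in> carrier G \<Longrightarrow> card (A #> x) = card A"
  unfolding r_coset_def UNION_singleton_eq_range
  by (intro card_image inj_onI) (meson r_cancel subsetD)

lemma card_l_coset: "A \<subseteq> carrier G \<Longrightarrow> x \<in> carrier G \<Longrightarrow> card (x <# A) = card A"
  unfolding l_coset_def UNION_singleton_eq_range
  by (intro card_image inj_onI) (meson l_cancel subsetD)

text \<open>By right cancellation \<open>A\<close> and its translate have equal size, and both
  differences arise by removing the same intersection.\<close>

lemma card_Diff_r_coset:
  assumes "finite A" "A \<subseteq> carrier G" "x \<in> carrier G"
  shows "card (A - (A #> x)) = card ((A #> x) - A)"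
proof -
  have fin: "finite (A #> x)" using assms(1) by (simp add: r_coset_def)
  show ?thesis
    using card_r_coset[OF assms(2,3)] card_Int_Diff[OF assms(1), of "A #> x"] card_Int_Diff[OF fin, of A]
    by (simp add: Int_commute)
qed

text \<open>Since \<open>K\<close> need not contain the unit, the centre is required to lie in
  \<open>A\<close> separately. Trajectories along sets of centres can then be compared with those
  along \<open>A\<close>.\<close>

definition translates_inside :: "'a set \<Rightarrow> 'a set \<Rightarrow> 'a set" where
  "translates_inside K A = {s \<in> A. s <# K \<subseteq> A}"

text \<open>Double counting of the pairs \<open>(s, k)\<close> with \<open>s \<otimes> k\<close> in
  \<open>U\<close>: by right cancellation such a pair is determined by \<open>s \<otimes> k\<close>
  and \<open>k\<close>.\<close>

lemma card_translates_meeting: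
  assumes fin: "finite A" "finite K" "finite U" and car: "A \<subseteq> carrier G" "K \<subseteq> carrier G"
  shows "(\<Sum>s\<in>A. card ((s <# K) \<inter> U)) \<le> card U * card K"
proof -
  have "card ((s <# K) \<inter> U) = card {k \<in> K. s \<otimes> k \<in> U}" if "s \<in> A" for s
  proof -
    have "(s <# K) \<inter> U = (\<lambda>k. s \<otimes> k) ` {k \<in> K. s \<otimes> k \<in> U}"
      unfolding l_coset_def by auto
    moreover have "inj_on (\<lambda>k. s \<otimes> k) {k \<in> K. s \<otimes> k \<in> U}"
      using that car by (intro inj_onI) (auto dest!: l_cancel)
    ultimately show ?thesis by (simp add: card_image)
  qed
  then have "(\<Sum>s\<in>A. card ((s <# K) \<inter> U)) = card (SIGMA s:A. {k \<in> K. s \<otimes> k \<in> U})"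
    using fin by (subst card_SigmaI) auto
  also have "\<dots> \<le> card (U \<times> K)"
  proof (rule card_inj_on_le)
    show "inj_on (\<lambda>(s, k). (s \<otimes> k, k)) (SIGMA s:A. {k \<in> K. s \<otimes> k \<in> U})"
      using car by (intro inj_onI) (auto dest!: r_cancel)
  qed (use fin in auto)
  finally show ?thesis by (simp add: card_cartesian_product)
qed

text \<open>
  A maximal family of centres whose translates overlap little works: every further translate meets
  the union \<open>DK\<close> in at least the proportion \<open>e\<close>, while each point of \<open>DK\<close> lies in at most
  \<open>|K|\<close> translates, which bounds \<open>|DK|\<close> from below.
\<close>

lemma nearly_disjoint_translates:
  fixes e :: real
  assumes fin: "finite A" "finite K" and car: "A \<subseteq> carrier G" "K \<subseteq> carrier G"
    and "K \<noteq> {}" and e: "0 < e" "e < 1"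
  obtains D where "D \<subseteq> translates_inside K A"
    "(1 - e) * (card D * card K) \<le> card (D <#> K)"
    "e * card (translates_inside K A) \<le> card (D <#> K)"
proof -
  define good where
    "good D \<longleftrightarrow> D \<subseteq> translates_inside K A \<and> (1 - e) * (card D * card K) \<le> card (D <#> K)" for D
  have Tf: "finite (translates_inside K A)" and TA: "translates_inside K A \<subseteq> A"
    using fin unfolding translates_inside_def by auto
  have "good {}" unfolding good_def set_mult_def by simp
  moreover have "\<forall>D. good D \<longrightarrow> card D < Suc (card (translates_inside K A))"
    using Tf unfolding good_def by (auto simp: less_Suc_eq_le intro: card_mono)
  ultimately obtain D where D: "good D" and max: "\<And>D'. good D' \<Longrightarrow> card D' \<le> card D"
    using ex_has_greatest_nat[of good "{}" card "Suc (card (translates_inside K A))"] by blast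
  have DT: "D \<subseteq> translates_inside K A" using D unfolding good_def by blast
  have Df: "finite D" using DT Tf finite_subset by blast
  have Uf: "finite (D <#> K)" using Df fin unfolding set_mult_def by auto
  have big: "e * card K \<le> card ((s <# K) \<inter> (D <#> K))" if s: "s \<in> translates_inside K A" for s
  proof (cases "s \<in> D")
    case True
    then have "(s <# K) \<inter> (D <#> K) = s <# K" unfolding l_coset_def set_mult_def by auto
    then show ?thesis
      using card_l_coset[OF car(2), of s] s car e TA by (auto simp: mult_left_le_one_le)
  next
    case False
    have sK: "finite (s <# K)" "card (s <# K) = card K"
      using fin card_l_coset[OF car(2), of s] s car TA by (auto simp: l_coset_def)
    have ins: "insert s D <#> K = (D <#> K) \<union> (s <# K)"
      unfolding l_coset_def set_mult_def by auto
    \<comment> \<open>By maximality a new centre violates the lower bound on the union.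
      Inclusion-exclusion turns the missing points into overlap of \<open>s <# K\<close> with
      \<open>D <#> K\<close>.\<close>
    have "\<not> good (insert s D)" using max[of "insert s D"] False Df by auto
    then have "card (insert s D <#> K) < (1 - e) * (card (insert s D) * card K)"
      using s DT unfolding good_def by auto
    also have "\<dots> = (1 - e) * (card D * card K) + (1 - e) * card K"
      using False Df by (simp add: algebra_simps)
    also have "\<dots> \<le> card (D <#> K) + (1 - e) * card K" using D unfolding good_def by simp
    finally have "real (card ((D <#> K) \<union> (s <# K))) < card (D <#> K) + (1 - e) * card K"
      unfolding ins .
    moreover have "card ((D <#> K) \<union> (s <# K)) + card ((D <#> K) \<inter> (s <# K)) = card (D <#> K) + card K"
      using card_Un_Int[OF Uf sK(1)] sK(2) by simp
    ultimately show ?thesis by (simp add: Int_commute algebra_simps flip: of_nat_add)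
  qed
  have "e * card (translates_inside K A) * card K = (\<Sum>s\<in>translates_inside K A. e * card K)"
    by simp
  also have "\<dots> \<le> (\<Sum>s\<in>translates_inside K A. real (card ((s <# K) \<inter> (D <#> K))))"
    using big by (intro sum_mono) auto
  also have "\<dots> \<le> real (card (D <#> K) * card K)"
    using card_translates_meeting[OF Tf fin(2) Uf] TA car by (simp flip: of_nat_sum of_nat_mult)
  finally have "e * card (translates_inside K A) \<le> card (D <#> K)"
    using \<open>K \<noteq> {}\<close> fin by (simp add: card_gt_0_iff)
  then show ?thesis using that D unfolding good_def by blast
qed

text \<open>A point \<open>a \<otimes> l\<close> that leaves the remainder either leaves
  \<open>A\<close> or equals some \<open>c \<otimes> k\<close> in \<open>D <#> K\<close>. In the
  second case \<open>k\<close> is not in \<open>K #> l\<close>, since otherwise cancelling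
  \<open>l\<close> would put \<open>a\<close> itself into \<open>D <#> K\<close>.\<close>

lemma card_r_coset_Diff_remove:
  assumes fin: "finite A" "finite K" "finite D" and car: "A \<subseteq> carrier G" "K \<subseteq> carrier G"
    and D: "D \<subseteq> carrier G" and l: "l \<in> carrier G"
  shows "card (((A - (D <#> K)) #> l) - (A - (D <#> K))) \<le>
    card ((A #> l) - A) + card D * card ((K #> l) - K)"
proof -
  have "((A - (D <#> K)) #> l) - (A - (D <#> K)) \<subseteq> ((A #> l) - A) \<union> (\<Union>c\<in>D. c <# (K - (K #> l)))"
  proof
    fix x assume x: "x \<in> ((A - (D <#> K)) #> l) - (A - (D <#> K))"
    then obtain a where a: "a \<in> A" "a \<notin> D <#> K" "x = a \<otimes> l" unfolding r_coset_def by auto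
    show "x \<in> ((A #> l) - A) \<union> (\<Union>c\<in>D. c <# (K - (K #> l)))"
    proof (cases "x \<in> A")
      case True
      with x obtain c k where ck: "c \<in> D" "k \<in> K" "x = c \<otimes> k" unfolding set_mult_def by auto
      have "k \<noteq> k' \<otimes> l" if k': "k' \<in> K" for k'
      proof
        assume "k = k' \<otimes> l"
        with ck a have "a \<otimes> l = (c \<otimes> k') \<otimes> l"
          using car D l k' by (metis m_assoc subsetD)
        then have "a = c \<otimes> k'" using r_cancel a ck k' car D l by (meson m_closed subsetD)
        then show False using a ck k' unfolding set_mult_def by auto
      qed
      then have "k \<in> K - (K #> l)" using ck unfolding r_coset_def by blast
      then have "x \<in> c <# (K - (K #> l))" using ck(3) unfolding l_coset_def by blast
      then show ?thesis using ck(1) by blast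
    qed (use a in \<open>auto simp: r_coset_def\<close>)
  qed
  then have "card (((A - (D <#> K)) #> l) - (A - (D <#> K))) \<le>
      card (((A #> l) - A) \<union> (\<Union>c\<in>D. c <# (K - (K #> l))))"
    using fin by (intro card_mono) (auto simp: r_coset_def l_coset_def)
  also have "\<dots> \<le> card ((A #> l) - A) + (\<Sum>c\<in>D. card (c <# (K - (K #> l))))"
    by (rule order_trans[OF card_Un_le add_left_mono[OF card_UN_le[OF fin(3)]]])
  also have "(\<Sum>c\<in>D. card (c <# (K - (K #> l)))) = (\<Sum>c\<in>D. card (K - (K #> l)))"
    using D car by (intro sum.cong card_l_coset) auto
  finally show ?thesis using card_Diff_r_coset[OF fin(2) car(2) l] by simp
qed

text \<open>A point \<open>s\<close> of \<open>A\<close> fails to be a centre only because some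
  \<open>s \<otimes> k\<close> is outside \<open>A\<close>. For fixed \<open>k\<close> the map from
  \<open>s\<close> to \<open>s \<otimes> k\<close> injects these failures into
  \<open>(A #> k) - A\<close>.\<close>

lemma card_outside_translates_inside:
  assumes "finite A" "finite K" "A \<subseteq> carrier G" "K \<subseteq> carrier G"
  shows "card (A - translates_inside K A) \<le> (\<Sum>k\<in>K. card ((A #> k) - A))"
proof -
  have "A - translates_inside K A = (\<Union>k\<in>K. {s \<in> A. s \<otimes> k \<notin> A})"
    unfolding translates_inside_def l_coset_def by auto
  then have "card (A - translates_inside K A) \<le> (\<Sum>k\<in>K. card {s \<in> A. s \<otimes> k \<notin> A})"
    using card_UN_le[OF assms(2), of "\<lambda>k. {s \<in> A. s \<otimes> k \<notin> A}"] by simp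
  also have "\<dots> \<le> (\<Sum>k\<in>K. card ((A #> k) - A))"
  proof (rule sum_mono)
    fix k assume k: "k \<in> K"
    show "card {s \<in> A. s \<otimes> k \<notin> A} \<le> card ((A #> k) - A)"
    proof (rule card_inj_on_le)
      show "inj_on (\<lambda>s. s \<otimes> k) {s \<in> A. s \<otimes> k \<notin> A}"
        using k assms by (intro inj_onI) (auto dest!: r_cancel)
    qed (use assms in \<open>auto simp: r_coset_def\<close>)
  qed
  finally show ?thesis .
qed

text \<open>Near-disjointness is stated through total counts: the sizes of all translates, with
  multiplicity, exceed the size of their union by at most the factor \<open>1 / (1 - e)\<close>.
  This covers overlaps within one shape and between shapes alike.\<close>

definition quasi_tiles :: "real \<Rightarrow> nat \<Rightarrow> (nat \<Rightarrow> 'a set) \<Rightarrow> (nat \<Rightarrow> 'a set) \<Rightarrow> 'a set \<Rightarrow> bool" where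
  "quasi_tiles e n K D A \<longleftrightarrow>
     (\<forall>i<n. D i \<subseteq> A \<and> D i <#> K i \<subseteq> A) \<and>
     (1 - e) * (\<Sum>i<n. real (card (D i) * card (K i))) \<le> card (\<Union>i<n. D i <#> K i)"

text \<open>This is the statement for induction on the number of shapes. Invariance is measured
  against a bound \<open>m\<close> instead of \<open>card A\<close>, because the set to be tiled
  shrinks while its boundary is still controlled by the original size. The maximum records that each
  shape either shrinks the remainder by a fixed factor or finds it already below
  \<open>e * m\<close>.\<close>

definition tiling_family :: "real \<Rightarrow> 'a set set \<Rightarrow> nat \<Rightarrow> (nat \<Rightarrow> 'a set) \<Rightarrow> 'a set \<Rightarrow> real \<Rightarrow> bool" where
  "tiling_family e \<K> n K L d \<longleftrightarrow>
    (\<forall>i<n. K i \<in> \<K> \<and> finite (K i) \<and> K i \<subseteq> carrier G) \<and> finite L \<and> L \<subseteq> carrier G \<and> d > 0 \<and>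
    (\<forall>A m. finite A \<longrightarrow> A \<subseteq> carrier G \<longrightarrow> card A \<le> m \<longrightarrow>
      (\<forall>l\<in>L. real (card ((A #> l) - A)) \<le> d * m) \<longrightarrow>
      (\<exists>D. quasi_tiles e n K D A \<and>
        real (card (A - (\<Union>i<n. D i <#> K i))) \<le> max (e * m) ((1 - e / 2) ^ n * card A)))"

lemma tiling_familyD:
  assumes "tiling_family e \<K> n K L d"
  shows "\<And>i. i < n \<Longrightarrow> K i \<in> \<K> \<and> finite (K i) \<and> K i \<subseteq> carrier G"
    and "finite L" "L \<subseteq> carrier G" "d > 0"
    and "\<And>A m. \<lbrakk>finite A; A \<subseteq> carrier G; card A \<le> m; \<forall>l\<in>L. real (card ((A #> l) - A)) \<le> d * m\<rbrakk> \<Longrightarrow>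
      \<exists>D. quasi_tiles e n K D A \<and>
        real (card (A - (\<Union>i<n. D i <#> K i))) \<le> max (e * m) ((1 - e / 2) ^ n * card A)"
  using assms unfolding tiling_family_def by simp_all

text \<open>
  The tile with the largest index is used first.  It is chosen so invariant under the parameter set
  of the smaller tiles that removing its translates leaves a set still good enough for them.
\<close>

lemma tiling_family_exists:
  fixes e :: real
  assumes freq: "frequently (\<lambda>K. K \<in> \<K>) folner_filter" and e: "0 < e" "e \<le> 1 / 2"
  shows "\<exists>K L d. tiling_family e \<K> n K L d"
proof (induction n)
  case 0
  have "\<exists>d::real. d > 0" by (rule exI[of _ 1]) simp
  then show ?case unfolding quasi_tiles_def tiling_family_def by auto
next
  case (Suc n)
  then obtain K L d where KLd: "tiling_family e \<K> n K L d" by blast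
  note K = tiling_familyD(1)[OF KLd] and L = tiling_familyD(2,3)[OF KLd]
    and d = tiling_familyD(4)[OF KLd] and tile = tiling_familyD(5)[OF KLd]
  have "frequently (\<lambda>K. K \<in> \<K> \<and> nearly_invariant L (d / 4) K) folner_filter"
    using frequently_eventually_frequently[OF freq eventually_nearly_invariant[OF L]] d by simp
  then obtain K' where K': "K' \<in> \<K>" "nearly_invariant L (d / 4) K'"
    using frequently_ex by blast
  then have K'f: "finite K'" "K' \<noteq> {}" "K' \<subseteq> carrier G"
    and K'L: "\<And>l. l \<in> L \<Longrightarrow> card ((K' #> l) - K') \<le> d / 4 * card K'"
    unfolding nearly_invariant_def by auto
  have cK': "card K' > 0" using K'f by (simp add: card_gt_0_iff)
  \<comment> \<open>The first bound keeps half of the boundary budget \<open>d * m\<close> for the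
    smaller tiles. The second loses at most \<open>e / 2 * m\<close> centres, hence at most half of
    \<open>A\<close> as soon as \<open>card A\<close> exceeds \<open>e * m\<close>.\<close>
  define d' where "d' = min (d / 2) (e / (2 * card K'))"
  have d': "d' > 0" "d' \<le> d / 2" "card K' * d' \<le> e / 2"
  proof -
    have "d' \<le> e / (2 * card K')" unfolding d'_def by simp
    then show "card K' * d' \<le> e / 2" using cK' by (simp add: field_simps)
  qed (use d e cK' in \<open>auto simp: d'_def\<close>)
  have step: "\<exists>D. quasi_tiles e (Suc n) (K(n := K')) D A \<and>
        real (card (A - (\<Union>i<Suc n. D i <#> (K(n := K')) i))) \<le> max (e * m) ((1 - e / 2) ^ Suc n * card A)"
    if A: "finite A" "A \<subseteq> carrier G" "card A \<le> m"
      and bd: "\<forall>l\<in>L \<union> K'. real (card ((A #> l) - A)) \<le> d' * m" for A m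
  \<comment> \<open>If \<open>A\<close> is already small, no translates are used at all.\<close>
  proof (cases "card A \<le> e * m")
    case True
    then show ?thesis
      by (intro exI[of _ "\<lambda>_. {}"]) (auto simp: quasi_tiles_def set_mult_def)
  next
    case False
    have m: "m \<ge> 0" using A by linarith
    let ?T = "translates_inside K' A"
    have TA: "?T \<subseteq> A" unfolding translates_inside_def by auto
    have "real (card (A - ?T)) \<le> (\<Sum>k\<in>K'. real (card ((A #> k) - A)))"
      using card_outside_translates_inside[OF A(1) K'f(1) A(2) K'f(3)]
      by (simp flip: of_nat_sum)
    also have "\<dots> \<le> (\<Sum>k\<in>K'. d' * m)" using bd by (intro sum_mono) auto
    also have "\<dots> = card K' * d' * m" by simp
    also have "\<dots> \<le> e / 2 * m" using d'(3) m by (intro mult_right_mono) auto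
    finally have "real (card (A - ?T)) \<le> card A / 2" using False by simp
    moreover have "card A = card ?T + card (A - ?T)"
      using card_Int_Diff[OF A(1), of ?T] TA by (simp add: Int_absorb1)
    ultimately have T: "card ?T \<ge> real (card A) / 2" by simp
    obtain D0 where D0: "D0 \<subseteq> ?T" "(1 - e) * (card D0 * card K') \<le> card (D0 <#> K')"
      "e * card ?T \<le> card (D0 <#> K')"
      using nearly_disjoint_translates[OF A(1) K'f(1) A(2) K'f(3,2), of e] e by auto
    define A' where "A' = A - (D0 <#> K')"
    have D0A: "D0 \<subseteq> A" "D0 <#> K' \<subseteq> A"
      using D0(1) unfolding translates_inside_def set_mult_def l_coset_def by auto
    have D0f: "finite D0" "finite (D0 <#> K')" using D0A A(1) finite_subset by blast+
    have A': "finite A'" "A' \<subseteq> carrier G" "A' \<subseteq> A" using A unfolding A'_def by auto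
    have cA: "card A = card A' + card (D0 <#> K')"
      unfolding A'_def using card_Diff_subset[OF D0f(2) D0A(2)] card_mono[OF A(1) D0A(2)] by simp
    \<comment> \<open>Half of \<open>A\<close> consists of centres, so the translates of
      \<open>K'\<close> cover the proportion \<open>e / 2\<close> of \<open>A\<close>; this is the
      source of the geometric factor.\<close>
    have "e * (card A / 2) \<le> e * card ?T" using T e by (intro mult_left_mono) auto
    then have small: "card A' \<le> (1 - e / 2) * card A"
      using D0(3) cA by (simp add: algebra_simps)
    \<comment> \<open>As \<open>e \<le> 1 / 2\<close>, multiplicities at most double the covered
      size. The translates of \<open>K'\<close> thus add at most \<open>d / 4 * (2 * m)\<close> to
      the boundary, the other half of the budget.\<close>
    have D0m: "real (card D0 * card K') \<le> 2 * m"
    proof -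
      have "1 / 2 * real (card D0 * card K') \<le> (1 - e) * real (card D0 * card K')"
        using e by (intro mult_right_mono) auto
      then show ?thesis using D0(2) cA A(3) by simp
    qed
    have "real (card ((A' #> l) - A')) \<le> d * m" if l: "l \<in> L" for l
    proof -
      have "real (card ((A' #> l) - A')) \<le> real (card ((A #> l) - A)) + card D0 * real (card ((K' #> l) - K'))"
        using card_r_coset_Diff_remove[OF A(1) K'f(1) D0f(1) A(2) K'f(3)] D0A(1) A(2) L(2) l
        unfolding A'_def by (simp flip: of_nat_add of_nat_mult add: subset_iff)
      also have "\<dots> \<le> d' * m + card D0 * (d / 4 * card K')"
        using bd l K'L[OF l] by (intro add_mono mult_left_mono) auto
      also have "\<dots> = d' * m + d / 4 * real (card D0 * card K')" by simp
      also have "\<dots> \<le> d / 2 * m + d / 4 * (2 * m)"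
        using d' d m D0m by (intro add_mono mult_left_mono mult_right_mono) auto
      finally show ?thesis by simp
    qed
    moreover have "card A' \<le> m" using cA A(3) by simp
    ultimately obtain D where D: "quasi_tiles e n K D A'"
      and rest: "real (card (A' - (\<Union>i<n. D i <#> K i))) \<le> max (e * m) ((1 - e / 2) ^ n * card A')"
      using tile[OF A'(1,2)] by blast
    let ?U = "\<Union>i<n. D i <#> K i"
    have UA': "?U \<subseteq> A'" using D unfolding quasi_tiles_def by auto
    have U: "(\<Union>i<Suc n. (D(n := D0)) i <#> (K(n := K')) i) = ?U \<union> (D0 <#> K')"
    proof -
      have "(\<Union>i<n. (D(n := D0)) i <#> (K(n := K')) i) = ?U" by (intro SUP_cong) auto
      then show ?thesis by (simp add: lessThan_Suc Un_commute)
    qed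
    have sum: "(\<Sum>i<Suc n. real (card ((D(n := D0)) i) * card ((K(n := K')) i))) =
        (\<Sum>i<n. real (card (D i) * card (K i))) + real (card D0 * card K')" by simp
    have "card (?U \<union> (D0 <#> K')) = card ?U + card (D0 <#> K')"
    proof (rule card_Un_disjoint)
      show "finite ?U" using UA' A'(1) by (rule finite_subset)
      show "?U \<inter> (D0 <#> K') = {}" using UA' unfolding A'_def by blast
    qed (rule D0f)
    then have "(1 - e) * ((\<Sum>i<n. real (card (D i) * card (K i))) + real (card D0 * card K'))
        \<le> card (?U \<union> (D0 <#> K'))"
      using D D0(2) unfolding quasi_tiles_def distrib_left by simp
    then have "quasi_tiles e (Suc n) (K(n := K')) (D(n := D0)) A"
      using D D0A A'(3) unfolding quasi_tiles_def U sum
      by (simp add: less_Suc_eq) blast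
    moreover have "real (card (A - (\<Union>i<Suc n. (D(n := D0)) i <#> (K(n := K')) i)))
        \<le> max (e * m) ((1 - e / 2) ^ Suc n * card A)"
    proof -
      have "A - (?U \<union> (D0 <#> K')) = A' - ?U" unfolding A'_def by auto
      moreover have "(1 - e / 2) ^ n * card A' \<le> (1 - e / 2) ^ Suc n * card A"
        using mult_left_mono[OF small, of "(1 - e / 2) ^ n"] e by (simp add: mult_ac)
      ultimately show ?thesis
        unfolding U using rest by (simp only:)
    qed
    ultimately show ?thesis by blast
  qed
  show ?case
    unfolding tiling_family_def using K K' K'f L d' step
    by (intro exI[of _ "K(n := K')"] exI[of _ "L \<union> K'"] exI[of _ d']) (auto simp: less_Suc_eq)
qed

text \<open>With \<open>m = card A\<close> and \<open>n\<close> so large that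
  \<open>(1 - e / 2) ^ n < e\<close>, both terms of the maximum are at most
  \<open>e * card A\<close>. The shapes are fixed before \<open>A\<close>; only the centres depend
  on it.\<close>

lemma quasi_tiling:
  fixes e :: real
  assumes freq: "frequently (\<lambda>K. K \<in> \<K>) folner_filter" and e: "0 < e" "e \<le> 1 / 2"
  shows "\<exists>n K. (\<forall>i<n. K i \<in> \<K> \<and> finite (K i) \<and> K i \<subseteq> carrier G) \<and>
    eventually (\<lambda>A. \<exists>D. quasi_tiles e n K D A \<and>
      real (card (A - (\<Union>i<n. D i <#> K i))) \<le> e * card A) folner_filter"
proof -
  have "(\<lambda>n. (1 - e / 2) ^ n) \<longlonglongrightarrow> 0" using e by (intro LIMSEQ_realpow_zero) auto
  then have "eventually (\<lambda>n. (1 - e / 2) ^ n < e) sequentially" using e by (simp add: order_tendstoD)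
  then obtain n where n: "(1 - e / 2) ^ n < e" by (auto dest: eventually_happens)
  obtain K L d where KLd: "tiling_family e \<K> n K L d"
    using tiling_family_exists[OF freq e] by blast
  note K = tiling_familyD(1)[OF KLd] and L = tiling_familyD(2-4)[OF KLd]
    and tile = tiling_familyD(5)[OF KLd]
  have "eventually (\<lambda>A. \<exists>D. quasi_tiles e n K D A \<and>
      real (card (A - (\<Union>i<n. D i <#> K i))) \<le> e * card A) folner_filter"
    using eventually_nearly_invariant[OF L]
  proof eventually_elim
    case (elim A)
    then obtain D where D: "quasi_tiles e n K D A"
      "real (card (A - (\<Union>i<n. D i <#> K i))) \<le> max (e * card A) ((1 - e / 2) ^ n * card A)"
      using tile[of A "card A"] unfolding nearly_invariant_def by auto
    have "(1 - e / 2) ^ n * card A \<le> e * card A" using n by (intro mult_right_mono) auto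
    then show ?case using D by (intro exI[of _ D]) auto
  qed
  then show ?thesis using K by (intro exI[of _ n] exI[of _ K]) simp
qed

end

section \<open>Trajectories\<close>

lemma finite_set_mult: "finite A \<Longrightarrow> finite B \<Longrightarrow> finite (A <#>\<^bsub>G\<^esub> B)"
  unfolding set_mult_def by auto

lemma card_set_mult_le:
  assumes "finite A" "finite B"
  shows "card (A <#>\<^bsub>G\<^esub> B) \<le> card A * card B"
proof -
  have "A <#>\<^bsub>G\<^esub> B = (\<lambda>(a, b). a \<otimes>\<^bsub>G\<^esub> b) ` (A \<times> B)" unfolding set_mult_def by auto
  then show ?thesis using card_image_le[of "A \<times> B"] assms by (simp add: card_cartesian_product)
qed

lemma (in comm_group) set_mult_comm:
  assumes "A \<subseteq> carrier G" "B \<subseteq> carrier G"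
  shows "A <#> B = B <#> A"
  using assms unfolding set_mult_def by (fastforce simp: m_comm subset_iff)

lemma (in comm_group) set_mult_interchange:
  assumes "A \<subseteq> carrier G" "B \<subseteq> carrier G" "C \<subseteq> carrier G" "D \<subseteq> carrier G"
  shows "(A <#> B) <#> (C <#> D) = (A <#> C) <#> (B <#> D)"
  using assms set_mult_comm[of B C]
  by (metis set_mult_assoc set_mult_closed)

locale monoid_action = S: monoid_cancel S + X: comm_group X
  for S :: "('s, 'm) monoid_scheme" and X :: "('a, 'b) monoid_scheme" +
  fixes lam :: "'s \<Rightarrow> 'a \<Rightarrow> 'a"
  assumes action: "left_action S X lam"
begin

abbreviation T :: "'s set \<Rightarrow> 'a set \<Rightarrow> 'a set" where
  "T \<equiv> trajectory X lam"

lemma lam_hom: "s \<in> carrier S \<Longrightarrow> lam s \<in> hom X X"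
  using action unfolding left_action_def by blast

lemma lam_closed: "s \<in> carrier S \<Longrightarrow> x \<in> carrier X \<Longrightarrow> lam s x \<in> carrier X"
  using lam_hom by (auto simp: hom_def)

lemma lam_mult:
  "s \<in> carrier S \<Longrightarrow> x \<in> carrier X \<Longrightarrow> y \<in> carrier X \<Longrightarrow> lam s (x \<otimes>\<^bsub>X\<^esub> y) = lam s x \<otimes>\<^bsub>X\<^esub> lam s y"
  using lam_hom by (auto simp: hom_def)

lemma lam_one: "s \<in> carrier S \<Longrightarrow> lam s \<one>\<^bsub>X\<^esub> = \<one>\<^bsub>X\<^esub>"
  by (rule hom_one[OF lam_hom]) (simp_all add: X.group_axioms)

lemma lam_id: "x \<in> carrier X \<Longrightarrow> lam \<one>\<^bsub>S\<^esub> x = x"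
  using action unfolding left_action_def by blast

lemma lam_compose:
  "s \<in> carrier S \<Longrightarrow> t \<in> carrier S \<Longrightarrow> x \<in> carrier X \<Longrightarrow> lam (s \<otimes>\<^bsub>S\<^esub> t) x = lam s (lam t x)"
  using action unfolding left_action_def by blast

lemma lam_image: "s \<in> carrier S \<Longrightarrow> E \<subseteq> carrier X \<Longrightarrow> lam s ` E \<subseteq> carrier X"
  using lam_closed by blast

lemma trajectory_empty: "T {} E = {\<one>\<^bsub>X\<^esub>}"
  unfolding trajectory_def by auto

text \<open>As \<open>s\<close> is not in \<open>F\<close>, the choice at \<open>s\<close> is
  independent of the choices on \<open>F\<close>. The resulting recursion replaces explicit choice
  functions in the inductions that follow.\<close>

lemma trajectory_insert:
  assumes F: "finite F" "s \<notin> F" "s \<in> carrier S" "F \<subseteq> carrier S" and E: "E \<subseteq> carrier X"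
  shows "T (insert s F) E = lam s ` E <#>\<^bsub>X\<^esub> T F E"
proof (intro equalityI subsetI)
  fix x assume "x \<in> T (insert s F) E"
  then obtain f where f: "\<forall>t\<in>insert s F. f t \<in> lam t ` E" "x = finprod X f (insert s F)"
    unfolding trajectory_def by blast
  have "f \<in> F \<rightarrow> carrier X" "f s \<in> carrier X" using f(1) lam_image[OF _ E] F by blast+
  then have "x = f s \<otimes>\<^bsub>X\<^esub> finprod X f F" using F f(2) by simp
  moreover have "finprod X f F \<in> T F E" using f(1) unfolding trajectory_def by blast
  ultimately show "x \<in> lam s ` E <#>\<^bsub>X\<^esub> T F E" using f(1) unfolding set_mult_def by blast
next
  fix x assume "x \<in> lam s ` E <#>\<^bsub>X\<^esub> T F E"
  then obtain y f where y: "y \<in> lam s ` E" and f: "\<forall>t\<in>F. f t \<in> lam t ` E"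
    and x: "x = y \<otimes>\<^bsub>X\<^esub> finprod X f F"
    unfolding set_mult_def trajectory_def by blast
  have fc: "f \<in> F \<rightarrow> carrier X" using f lam_image[OF _ E] F by blast
  have yc: "y \<in> carrier X" using y lam_image[OF _ E] F by blast
  have fy: "f(s := y) \<in> F \<rightarrow> carrier X" using fc F(2) by (auto simp: Pi_iff)
  have "finprod X (f(s := y)) (insert s F) = y \<otimes>\<^bsub>X\<^esub> finprod X (f(s := y)) F"
    using X.finprod_insert[OF F(1,2) fy] yc by simp
  also have "finprod X (f(s := y)) F = finprod X f F"
    by (rule X.finprod_cong') (use fc F(2) in auto)
  finally have "x = finprod X (f(s := y)) (insert s F)" by (simp only: x)
  moreover have "\<forall>t\<in>insert s F. (f(s := y)) t \<in> lam t ` E" using f y F(2) by auto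
  ultimately show "x \<in> T (insert s F) E" unfolding trajectory_def by blast
qed

lemma trajectory_closed:
  assumes "F \<subseteq> carrier S" "E \<subseteq> carrier X"
  shows "T F E \<subseteq> carrier X"
proof
  fix x assume "x \<in> T F E"
  then obtain f where f: "\<forall>t\<in>F. f t \<in> lam t ` E" "x = finprod X f F"
    unfolding trajectory_def by blast
  then have "f \<in> F \<rightarrow> carrier X" using lam_image assms by blast
  then show "x \<in> carrier X" using f(2) by simp
qed

lemma finite_trajectory:
  assumes "finite F" "F \<subseteq> carrier S" "finite E" "E \<subseteq> carrier X"
  shows "finite (T F E)" "card (T F E) \<le> card E ^ card F"
proof -
  have "finite (T F E) \<and> card (T F E) \<le> card E ^ card F"
    using assms
  proof (induction F rule: finite_induct)
    case (insert s F)
    then have IH: "finite (T F E)" "card (T F E) \<le> card E ^ card F" by auto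
    have "card (lam s ` E <#>\<^bsub>X\<^esub> T F E) \<le> card (lam s ` E) * card (T F E)"
      using insert IH by (intro card_set_mult_le) auto
    also have "\<dots> \<le> card E * card E ^ card F"
      using IH insert by (intro mult_mono card_image_le) auto
    finally show ?case
      using trajectory_insert[of F s E] insert IH by (simp add: finite_set_mult)
  qed (simp add: trajectory_empty)
  then show "finite (T F E)" "card (T F E) \<le> card E ^ card F" by auto
qed

lemma one_in_trajectory:
  assumes "F \<subseteq> carrier S" "\<one>\<^bsub>X\<^esub> \<in> E"
  shows "\<one>\<^bsub>X\<^esub> \<in> T F E"
proof -
  have "\<one>\<^bsub>X\<^esub> = finprod X (\<lambda>_. \<one>\<^bsub>X\<^esub>) F" by simp
  moreover have "\<forall>s\<in>F. \<one>\<^bsub>X\<^esub> \<in> lam s ` E" using assms lam_one by force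
  ultimately show ?thesis unfolding trajectory_def by blast
qed

lemma card_trajectory_pos:
  assumes "finite F" "F \<subseteq> carrier S" "finite E" "E \<subseteq> carrier X" "\<one>\<^bsub>X\<^esub> \<in> E"
  shows "card (T F E) > 0"
  using finite_trajectory(1)[OF assms(1-4)] one_in_trajectory[OF assms(2,5)]
  by (auto simp: card_gt_0_iff)

section \<open>How trajectories depend on the index set and on the generating set\<close>

lemma trajectory_mono_right:
  "E \<subseteq> E' \<Longrightarrow> T F E \<subseteq> T F E'"
  unfolding trajectory_def by blast

lemma trajectory_Un_disjoint:
  assumes "finite A" "finite B" "A \<inter> B = {}" "A \<subseteq> carrier S" "B \<subseteq> carrier S" "E \<subseteq> carrier X"
  shows "T (A \<union> B) E = T A E <#>\<^bsub>X\<^esub> T B E"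
  using assms
proof (induction A rule: finite_induct)
  case empty
  then have "T B E \<subseteq> carrier X" by (intro trajectory_closed)
  then show ?case by (force simp: trajectory_empty set_mult_def subset_iff)
next
  case (insert s A)
  then have "T (insert s (A \<union> B)) E = lam s ` E <#>\<^bsub>X\<^esub> (T A E <#>\<^bsub>X\<^esub> T B E)"
    using trajectory_insert[of "A \<union> B" s E] by auto
  also have "\<dots> = T (insert s A) E <#>\<^bsub>X\<^esub> T B E"
    using insert X.set_mult_assoc[of "lam s ` E" "T A E" "T B E"]
    by (simp add: trajectory_insert trajectory_closed lam_image)
  finally show ?case by simp
qed

lemma subset_set_mult_left:
  "\<one>\<^bsub>X\<^esub> \<in> B \<Longrightarrow> A \<subseteq> carrier X \<Longrightarrow> A \<subseteq> A <#>\<^bsub>X\<^esub> B"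
  unfolding set_mult_def by (force simp: subset_iff)

text \<open>The extra factor \<open>T (B - A) E\<close> contains the unit because \<open>E\<close>
  does.\<close>

lemma trajectory_mono:
  assumes "A \<subseteq> B" "finite B" "B \<subseteq> carrier S" "E \<subseteq> carrier X" "\<one>\<^bsub>X\<^esub> \<in> E"
  shows "T A E \<subseteq> T B E"
proof -
  have "T B E = T A E <#>\<^bsub>X\<^esub> T (B - A) E"
    using trajectory_Un_disjoint[of A "B - A" E] assms
    by (simp add: finite_subset Un_absorb1 subset_trans[of "B - A" B])
  then show ?thesis
    using assms by (metis Diff_subset one_in_trajectory order_trans subset_set_mult_left trajectory_closed)
qed

lemma trajectory_Un:
  assumes "finite A" "finite B" "A \<subseteq> carrier S" "B \<subseteq> carrier S" "E \<subseteq> carrier X" "\<one>\<^bsub>X\<^esub> \<in> E"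
  shows "T (A \<union> B) E \<subseteq> T A E <#>\<^bsub>X\<^esub> T B E"
proof -
  have "T (A \<union> B) E = T A E <#>\<^bsub>X\<^esub> T (B - A) E"
    using trajectory_Un_disjoint[of A "B - A" E] assms by auto
  also have "\<dots> \<subseteq> T A E <#>\<^bsub>X\<^esub> T B E"
    using assms by (intro mono_set_mult trajectory_mono) auto
  finally show ?thesis .
qed

text \<open>Left cancellation keeps the elements \<open>c \<otimes> k\<close> distinct, so no
  factors merge, and each factor is the image under \<open>lam c\<close> of the one at
  \<open>k\<close>.\<close>

lemma trajectory_l_coset:
  assumes "finite K" "K \<subseteq> carrier S" "c \<in> carrier S" "E \<subseteq> carrier X"
  shows "T (c <#\<^bsub>S\<^esub> K) E = lam c ` T K E"
  using assms
proof (induction K rule: finite_induct)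
  case empty
  then show ?case by (simp add: l_coset_def trajectory_empty lam_one)
next
  case (insert k K)
  have cK: "c <#\<^bsub>S\<^esub> insert k K = insert (c \<otimes>\<^bsub>S\<^esub> k) (c <#\<^bsub>S\<^esub> K)" unfolding l_coset_def by auto
  have "c \<otimes>\<^bsub>S\<^esub> k \<notin> c <#\<^bsub>S\<^esub> K"
    using insert S.l_cancel[of c k] unfolding l_coset_def by auto
  moreover have "finite (c <#\<^bsub>S\<^esub> K)" "c <#\<^bsub>S\<^esub> K \<subseteq> carrier S"
    using insert unfolding l_coset_def by auto
  ultimately have "T (c <#\<^bsub>S\<^esub> insert k K) E = lam (c \<otimes>\<^bsub>S\<^esub> k) ` E <#>\<^bsub>X\<^esub> lam c ` T K E"
    unfolding cK using insert by (subst trajectory_insert) auto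
  also have "lam (c \<otimes>\<^bsub>S\<^esub> k) ` E = lam c ` lam k ` E"
    unfolding image_image using insert.prems by (intro image_cong lam_compose) auto
  also have "lam c ` lam k ` E <#>\<^bsub>X\<^esub> lam c ` T K E = lam c ` (lam k ` E <#>\<^bsub>X\<^esub> T K E)"
    using insert.prems
    by (intro set_mult_hom[symmetric, OF lam_hom] lam_image trajectory_closed) auto
  also have "lam k ` E <#>\<^bsub>X\<^esub> T K E = T (insert k K) E"
    using insert by (simp add: trajectory_insert)
  finally show ?case .
qed

text \<open>Only an inclusion, since the translates of \<open>K\<close> may overlap: a common point
  gives one factor on the left and several on the right.\<close>

lemma trajectory_set_mult_left:
  assumes "finite D" "D \<subseteq> carrier S" "finite K" "K \<subseteq> carrier S" "E \<subseteq> carrier X" "\<one>\<^bsub>X\<^esub> \<in> E"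
  shows "T (D <#>\<^bsub>S\<^esub> K) E \<subseteq> T D (T K E)"
  using assms(1,2)
proof (induction D rule: finite_induct)
  case empty
  then show ?case by (simp add: set_mult_def trajectory_empty)
next
  case (insert c D)
  have DK: "insert c D <#>\<^bsub>S\<^esub> K = (c <#\<^bsub>S\<^esub> K) \<union> (D <#>\<^bsub>S\<^esub> K)"
    unfolding set_mult_def l_coset_def by auto
  have "finite (c <#\<^bsub>S\<^esub> K)" "c <#\<^bsub>S\<^esub> K \<subseteq> carrier S"
    using insert assms unfolding l_coset_def by auto
  moreover have "finite (D <#>\<^bsub>S\<^esub> K)" "D <#>\<^bsub>S\<^esub> K \<subseteq> carrier S"
    using insert assms by (auto simp: finite_set_mult S.set_mult_closed)
  ultimately have "T (insert c D <#>\<^bsub>S\<^esub> K) E \<subseteq> T (c <#\<^bsub>S\<^esub> K) E <#>\<^bsub>X\<^esub> T (D <#>\<^bsub>S\<^esub> K) E"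
    unfolding DK using assms by (intro trajectory_Un) auto
  also have "\<dots> \<subseteq> lam c ` T K E <#>\<^bsub>X\<^esub> T D (T K E)"
    using insert assms by (intro mono_set_mult) (auto simp: trajectory_l_coset)
  also have "\<dots> = T (insert c D) (T K E)"
    using insert assms by (simp add: trajectory_insert trajectory_closed)
  finally show ?case .
qed

lemma trajectory_set_mult_right:
  assumes "finite F" "F \<subseteq> carrier S" "A \<subseteq> carrier X" "B \<subseteq> carrier X"
  shows "T F (A <#>\<^bsub>X\<^esub> B) = T F A <#>\<^bsub>X\<^esub> T F B"
  using assms(1,2)
proof (induction F rule: finite_induct)
  case empty
  then show ?case by (simp add: set_mult_def trajectory_empty)
next
  case (insert s F)
  have "T (insert s F) (A <#>\<^bsub>X\<^esub> B) = lam s ` (A <#>\<^bsub>X\<^esub> B) <#>\<^bsub>X\<^esub> (T F A <#>\<^bsub>X\<^esub> T F B)"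
    using insert assms by (simp add: trajectory_insert X.set_mult_closed)
  also have "lam s ` (A <#>\<^bsub>X\<^esub> B) = lam s ` A <#>\<^bsub>X\<^esub> lam s ` B"
    using insert assms by (intro set_mult_hom lam_hom) auto
  also have "\<dots> <#>\<^bsub>X\<^esub> (T F A <#>\<^bsub>X\<^esub> T F B) = T (insert s F) A <#>\<^bsub>X\<^esub> T (insert s F) B"
    using insert assms
    by (simp add: trajectory_insert X.set_mult_interchange trajectory_closed lam_image)
  finally show ?case .
qed

text \<open>The order of quantifiers is the point: \<open>C\<close> is the product of all
  \<open>B i\<close> and is fixed before \<open>F\<close> and the centres. \<open>P\<close> is the
  product of the trajectories of \<open>A i\<close> along \<open>D i\<close>, each of size at most
  \<open>card (A i) ^ card (D i)\<close>.\<close>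

lemma trajectory_tiles:
  fixes n :: nat
  assumes E: "E \<subseteq> carrier X" "\<one>\<^bsub>X\<^esub> \<in> E" and Y: "subgroup Y X"
    and K: "\<And>i. i < n \<Longrightarrow> finite (K i) \<and> K i \<subseteq> carrier S"
    and A: "\<And>i. i < n \<Longrightarrow> finite (A i) \<and> A i \<subseteq> carrier X"
    and B: "\<And>i. i < n \<Longrightarrow> finite (B i) \<and> B i \<subseteq> Y \<and> \<one>\<^bsub>X\<^esub> \<in> B i"
    and KAB: "\<And>i. i < n \<Longrightarrow> T (K i) E \<subseteq> A i <#>\<^bsub>X\<^esub> B i"
  shows "\<exists>C. finite C \<and> C \<subseteq> Y \<and> \<one>\<^bsub>X\<^esub> \<in> C \<and>
    (\<forall>F D. finite F \<longrightarrow> F \<subseteq> carrier S \<longrightarrow> (\<forall>i<n. D i \<subseteq> F) \<longrightarrow>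
      (\<exists>P. finite P \<and> P \<subseteq> carrier X \<and> card P \<le> (\<Prod>i<n. card (A i) ^ card (D i)) \<and>
        T (\<Union>i<n. D i <#>\<^bsub>S\<^esub> K i) E \<subseteq> P <#>\<^bsub>X\<^esub> T F C))"
    (is "\<exists>C. ?Q n C")
  using K A B KAB
proof (induction n)
  case 0
  have one: "\<one>\<^bsub>X\<^esub> \<in> Y" using Y by (rule subgroup.one_closed)
  have "T {} E \<subseteq> {\<one>\<^bsub>X\<^esub>} <#>\<^bsub>X\<^esub> T F {\<one>\<^bsub>X\<^esub>}" if "F \<subseteq> carrier S" for F
    using one_in_trajectory[OF that, of "{\<one>\<^bsub>X\<^esub>}"] by (force simp: trajectory_empty set_mult_def)
  then show ?case using one
    by (intro exI[of _ "{\<one>\<^bsub>X\<^esub>}"] conjI allI impI) (auto intro!: exI[of _ "{\<one>\<^bsub>X\<^esub>}"])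
next
  case (Suc n)
  have Yc: "Y \<subseteq> carrier X" using Y by (rule subgroup.subset)
  have "\<exists>C. ?Q n C" by (rule Suc.IH) (rule Suc.prems, erule less_SucI)+
  then obtain C where C': "?Q n C" by (rule exE)
  then have C: "finite C" "C \<subseteq> Y" "\<one>\<^bsub>X\<^esub> \<in> C" by simp_all
  note IH = C'[THEN conjunct2, THEN conjunct2, THEN conjunct2, rule_format]
  have Kn: "finite (K n)" "K n \<subseteq> carrier S" and An: "finite (A n)" "A n \<subseteq> carrier X"
    and Bn: "finite (B n)" "B n \<subseteq> Y" "\<one>\<^bsub>X\<^esub> \<in> B n" and KABn: "T (K n) E \<subseteq> A n <#>\<^bsub>X\<^esub> B n"
    using Suc.prems by auto
  have Cc: "C \<subseteq> carrier X" and Bc: "B n \<subseteq> carrier X" using C Bn Yc by auto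
  have "C <#>\<^bsub>X\<^esub> B n \<subseteq> Y"
    using C Bn subgroup.m_closed[OF Y] unfolding set_mult_def by auto
  moreover have "\<one>\<^bsub>X\<^esub> \<in> C <#>\<^bsub>X\<^esub> B n"
    using C(3) Bn(3) Cc subset_set_mult_left by blast
  moreover have "\<exists>P. finite P \<and> P \<subseteq> carrier X \<and> card P \<le> (\<Prod>i<Suc n. card (A i) ^ card (D i)) \<and>
        T (\<Union>i<Suc n. D i <#>\<^bsub>S\<^esub> K i) E \<subseteq> P <#>\<^bsub>X\<^esub> T F (C <#>\<^bsub>X\<^esub> B n)"
    if F: "finite F" "F \<subseteq> carrier S" "\<forall>i<Suc n. D i \<subseteq> F" for F D
  proof -
    obtain P where P: "finite P" "P \<subseteq> carrier X" "card P \<le> (\<Prod>i<n. card (A i) ^ card (D i))"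
      and TP: "T (\<Union>i<n. D i <#>\<^bsub>S\<^esub> K i) E \<subseteq> P <#>\<^bsub>X\<^esub> T F C"
      using IH[OF F(1,2), of D] F(3) by auto
    have D: "finite (D i)" "D i \<subseteq> carrier S" if "i < Suc n" for i
      using F that finite_subset by blast+
    let ?U = "\<Union>i<n. D i <#>\<^bsub>S\<^esub> K i" and ?P = "P <#>\<^bsub>X\<^esub> T (D n) (A n)"
    have Dn: "finite (D n)" "D n \<subseteq> carrier S" "D n \<subseteq> F" using D F(3) by auto
    have DK: "finite (D i <#>\<^bsub>S\<^esub> K i)" "D i <#>\<^bsub>S\<^esub> K i \<subseteq> carrier S" if "i < Suc n" for i
      using D[OF that] Suc.prems(1)[OF that] by (auto intro!: finite_set_mult S.set_mult_closed del: subsetI)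
    have U: "finite ?U" "?U \<subseteq> carrier S" using DK by (auto simp: less_Suc_eq)
    have closed: "T (D n) (A n) \<subseteq> carrier X" "T F C \<subseteq> carrier X" "T F (B n) \<subseteq> carrier X"
      using trajectory_closed F(2) Dn An Cc Bc by auto
    have "T (D n <#>\<^bsub>S\<^esub> K n) E \<subseteq> T (D n) (T (K n) E)"
      by (rule trajectory_set_mult_left[OF Dn(1,2) Kn E])
    also have "\<dots> \<subseteq> T (D n) (A n <#>\<^bsub>X\<^esub> B n)" by (rule trajectory_mono_right[OF KABn])
    also have "\<dots> = T (D n) (A n) <#>\<^bsub>X\<^esub> T (D n) (B n)"
      by (rule trajectory_set_mult_right[OF Dn(1,2) An(2) Bc])
    \<comment> \<open>Here the centres are forgotten: \<open>D n\<close> lies in \<open>F\<close>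
      and \<open>B n\<close> contains the unit, so the trajectory along \<open>D n\<close> may be
      enlarged to all of \<open>F\<close>.\<close>
    also have "\<dots> \<subseteq> T (D n) (A n) <#>\<^bsub>X\<^esub> T F (B n)"
      by (intro mono_set_mult order_refl trajectory_mono Dn F Bc Bn)
    finally have TD: "T (D n <#>\<^bsub>S\<^esub> K n) E \<subseteq> T (D n) (A n) <#>\<^bsub>X\<^esub> T F (B n)" .
    have "(\<Union>i<Suc n. D i <#>\<^bsub>S\<^esub> K i) = ?U \<union> (D n <#>\<^bsub>S\<^esub> K n)"
      by (simp add: lessThan_Suc Un_commute)
    then have "T (\<Union>i<Suc n. D i <#>\<^bsub>S\<^esub> K i) E \<subseteq> T ?U E <#>\<^bsub>X\<^esub> T (D n <#>\<^bsub>S\<^esub> K n) E"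
      using trajectory_Un[OF U(1) DK(1) U(2) DK(2) E] by simp
    also have "\<dots> \<subseteq> (P <#>\<^bsub>X\<^esub> T F C) <#>\<^bsub>X\<^esub> (T (D n) (A n) <#>\<^bsub>X\<^esub> T F (B n))"
      by (rule mono_set_mult[OF TP TD])
    also have "\<dots> = ?P <#>\<^bsub>X\<^esub> T F (C <#>\<^bsub>X\<^esub> B n)"
      using closed P F Cc Bc by (simp add: X.set_mult_interchange trajectory_set_mult_right)
    finally have sub: "T (\<Union>i<Suc n. D i <#>\<^bsub>S\<^esub> K i) E \<subseteq> ?P <#>\<^bsub>X\<^esub> T F (C <#>\<^bsub>X\<^esub> B n)" .
    note TDA = finite_trajectory[OF Dn(1,2) An]
    have "card ?P \<le> card P * card (T (D n) (A n))" by (rule card_set_mult_le[OF P(1) TDA(1)])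
    also have "\<dots> \<le> (\<Prod>i<n. card (A i) ^ card (D i)) * card (A n) ^ card (D n)"
      by (intro mult_mono P TDA) auto
    finally have "card ?P \<le> (\<Prod>i<Suc n. card (A i) ^ card (D i))" by simp
    then show ?thesis
      using sub finite_set_mult[OF P(1) TDA(1)] X.set_mult_closed[OF P(2) closed(1)] by blast
  qed
  ultimately show ?case
    using finite_set_mult[OF C(1) Bn(1), of X] by (intro exI[of _ "C <#>\<^bsub>X\<^esub> B n"]) simp
qed

end

text \<open>Applied to the inclusion of \<open>Y\<close> and to the projection onto
  \<open>X Mod Y\<close>, this lets the trajectories of both induced actions be computed inside
  \<open>X\<close>.\<close>

lemma trajectory_equivariant_hom:
  assumes "monoid_action S X lam" "monoid_action S Z mu" and h: "h \<in> hom X Z"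
    and equi: "\<And>s x. s \<in> carrier S \<Longrightarrow> x \<in> carrier X \<Longrightarrow> h (lam s x) = mu s (h x)"
    and F: "finite F" "F \<subseteq> carrier S" and E: "E \<subseteq> carrier X"
  shows "trajectory Z mu F (h ` E) = h ` trajectory X lam F E"
proof -
  interpret X: monoid_action S X lam by fact
  interpret Z: monoid_action S Z mu by fact
  have hE: "h ` E \<subseteq> carrier Z" using h E by (auto simp: hom_def)
  show ?thesis using F
  proof (induction F rule: finite_induct)
    case empty
    then show ?case
      using hom_one[OF h] X.X.group_axioms Z.X.group_axioms
      by (simp add: X.trajectory_empty Z.trajectory_empty)
  next
    case (insert s F)
    have "mu s ` h ` E = h ` lam s ` E"
      unfolding image_image using insert.prems E equi by (intro image_cong) auto
    moreover have "h ` (lam s ` E <#>\<^bsub>X\<^esub> X.T F E) = h ` lam s ` E <#>\<^bsub>Z\<^esub> h ` X.T F E"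
      using insert.prems E by (intro set_mult_hom[OF h] X.lam_image X.trajectory_closed) auto
    ultimately show ?case
      using insert E hE by (simp add: X.trajectory_insert Z.trajectory_insert)
  qed
qed

section \<open>Entropy as a limit\<close>

text \<open>The left side tends to \<open>a\<close> as \<open>e\<close> decreases to 0. The factor
  \<open>1 / (1 - e)\<close> will pay for overlapping tiles, the term \<open>e * l\<close> for the
  uncovered part.\<close>

lemma small_correction:
  fixes a l b :: real
  assumes "a < b"
  obtains e where "0 < e" "e \<le> 1 / 2" "a / (1 - e) + e * l < b"
proof -
  have "((\<lambda>e. a / (1 - e) + e * l) \<longlongrightarrow> a / (1 - 0) + 0 * l) (at_right 0)"
    by (intro tendsto_intros) auto
  then have "eventually (\<lambda>e. a / (1 - e) + e * l < b) (at_right 0)"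
    using assms by (auto intro: order_tendstoD)
  moreover have "eventually (\<lambda>e::real. e \<in> {0<..<1/2}) (at_right 0)"
    by (rule eventually_at_right_real) simp
  ultimately have "eventually (\<lambda>e. 0 < e \<and> e \<le> 1 / 2 \<and> a / (1 - e) + e * l < b) (at_right 0)"
    by eventually_elim auto
  then show ?thesis using that eventually_happens[of _ "at_right (0::real)"] by auto
qed

context monoid_action
begin

text \<open>A large \<open>F\<close> splits into the part covered by tiles and a rest of size at
  most \<open>e * card F\<close>. The covered part lies in \<open>P <#> T F C\<close> by
  \<open>trajectory_tiles\<close>, and the rest contributes at most a factor \<open>card E\<close>
  per point.\<close>

lemma trajectory_growth:
  fixes a e :: real
  assumes E: "finite E" "E \<subseteq> carrier X" "\<one>\<^bsub>X\<^esub> \<in> E" and Y: "subgroup Y X"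
    and freq: "frequently (\<lambda>K. K \<in> \<K>) S.folner_filter"
    and cover: "\<And>K. K \<in> \<K> \<Longrightarrow> finite K \<Longrightarrow> K \<subseteq> carrier S \<Longrightarrow>
      \<exists>A B. finite A \<and> A \<subseteq> carrier X \<and> ln (card A) \<le> a * card K \<and>
        finite B \<and> B \<subseteq> Y \<and> \<one>\<^bsub>X\<^esub> \<in> B \<and> T K E \<subseteq> A <#>\<^bsub>X\<^esub> B"
    and a: "0 \<le> a" and e: "0 < e" "e \<le> 1 / 2"
  shows "\<exists>C. finite C \<and> C \<subseteq> Y \<and> \<one>\<^bsub>X\<^esub> \<in> C \<and>
    eventually (\<lambda>F. ln (card (T F E)) \<le> (a / (1 - e) + e * ln (card E)) * card F + ln (card (T F C)))
      S.folner_filter"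
proof -
  obtain n K where K: "\<forall>i<n. K i \<in> \<K> \<and> finite (K i) \<and> K i \<subseteq> carrier S"
    and tiles: "eventually (\<lambda>F. \<exists>D. S.quasi_tiles e n K D F \<and>
      real (card (F - (\<Union>i<n. D i <#>\<^bsub>S\<^esub> K i))) \<le> e * card F) S.folner_filter"
    using S.quasi_tiling[OF freq e] by (elim exE conjE) (rule that)
  have "\<forall>i\<in>{..<n}. \<exists>A B. finite A \<and> A \<subseteq> carrier X \<and> ln (card A) \<le> a * card (K i) \<and>
        finite B \<and> B \<subseteq> Y \<and> \<one>\<^bsub>X\<^esub> \<in> B \<and> T (K i) E \<subseteq> A <#>\<^bsub>X\<^esub> B"
    using K cover by simp
  then obtain A B where AB: "\<forall>i\<in>{..<n}. finite (A i) \<and> A i \<subseteq> carrier X \<and> ln (card (A i)) \<le> a * card (K i) \<and>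
        finite (B i) \<and> B i \<subseteq> Y \<and> \<one>\<^bsub>X\<^esub> \<in> B i \<and> T (K i) E \<subseteq> A i <#>\<^bsub>X\<^esub> B i"
    unfolding bchoice_iff by blast
  have "\<exists>C. finite C \<and> C \<subseteq> Y \<and> \<one>\<^bsub>X\<^esub> \<in> C \<and>
    (\<forall>F D. finite F \<longrightarrow> F \<subseteq> carrier S \<longrightarrow> (\<forall>i<n. D i \<subseteq> F) \<longrightarrow>
      (\<exists>P. finite P \<and> P \<subseteq> carrier X \<and> card P \<le> (\<Prod>i<n. card (A i) ^ card (D i)) \<and>
        T (\<Union>i<n. D i <#>\<^bsub>S\<^esub> K i) E \<subseteq> P <#>\<^bsub>X\<^esub> T F C))"
    using K AB by (intro trajectory_tiles[OF E(2,3) Y, where B = B]) auto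
  then obtain C where C: "finite C" "C \<subseteq> Y" "\<one>\<^bsub>X\<^esub> \<in> C"
    and P: "\<And>F D. finite F \<Longrightarrow> F \<subseteq> carrier S \<Longrightarrow> \<forall>i<n. D i \<subseteq> F \<Longrightarrow>
      \<exists>P. finite P \<and> P \<subseteq> carrier X \<and> card P \<le> (\<Prod>i<n. card (A i) ^ card (D i)) \<and>
        T (\<Union>i<n. D i <#>\<^bsub>S\<^esub> K i) E \<subseteq> P <#>\<^bsub>X\<^esub> T F C"
    by (elim exE conjE) auto
  have Cc: "C \<subseteq> carrier X" using C(2) subgroup.subset[OF Y] by blast
  \<comment> \<open>The unit lies in \<open>T (K i) E\<close>, so no \<open>A i\<close> is empty and
    all logarithms below are of positive numbers.\<close>
  have A0: "card (A i) > 0" if "i < n" for i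
  proof -
    have "\<one>\<^bsub>X\<^esub> \<in> A i <#>\<^bsub>X\<^esub> B i" using one_in_trajectory[OF _ E(3), of "K i"] K AB that by auto
    then show ?thesis using AB that by (auto simp: set_mult_def card_gt_0_iff)
  qed
  have cE: "card E > 0" using E by (auto simp: card_gt_0_iff)
  have lE: "ln (card E) \<ge> 0" using cE by simp
  have "eventually (\<lambda>F. ln (card (T F E)) \<le> (a / (1 - e) + e * ln (card E)) * card F + ln (card (T F C)))
      S.folner_filter"
    using tiles S.eventually_finite_folner_filter
  proof eventually_elim
    case (elim F)
    then have F: "finite F" "F \<subseteq> carrier S" by auto
    from elim(1) obtain D where D: "S.quasi_tiles e n K D F"
      and rest: "real (card (F - (\<Union>i<n. D i <#>\<^bsub>S\<^esub> K i))) \<le> e * card F" by (elim exE conjE) (rule that)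
    let ?U = "\<Union>i<n. D i <#>\<^bsub>S\<^esub> K i"
    have DF: "\<forall>i<n. D i \<subseteq> F" and U: "?U \<subseteq> F" and
      U': "(1 - e) * (\<Sum>i<n. real (card (D i) * card (K i))) \<le> card ?U"
      using D unfolding S.quasi_tiles_def by auto
    obtain P where P: "finite P" "P \<subseteq> carrier X" "card P \<le> (\<Prod>i<n. card (A i) ^ card (D i))"
      "T ?U E \<subseteq> P <#>\<^bsub>X\<^esub> T F C"
      using P[OF F DF] by (elim exE conjE) (rule that)
    have FU: "finite (F - ?U)" "F - ?U \<subseteq> carrier S" "finite ?U" "?U \<subseteq> carrier S"
      using F U finite_subset[OF U F(1)] by auto
    have TFC: "finite (T F C)" "card (T F C) > 0"
      using finite_trajectory[OF F C(1) Cc] card_trajectory_pos[OF F C(1) Cc C(3)] by auto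
    note TFU = finite_trajectory[OF FU(1,2) E(1,2)]
    have fin: "finite (P <#>\<^bsub>X\<^esub> T F C)" by (rule finite_set_mult[OF P(1) TFC(1)])
    have "T F E = T (?U \<union> (F - ?U)) E" using U by (simp add: Un_absorb1)
    also have "\<dots> \<subseteq> T ?U E <#>\<^bsub>X\<^esub> T (F - ?U) E"
      by (rule trajectory_Un[OF FU(3,1,4,2) E(2,3)])
    also have "\<dots> \<subseteq> (P <#>\<^bsub>X\<^esub> T F C) <#>\<^bsub>X\<^esub> T (F - ?U) E"
      by (intro mono_set_mult P order_refl)
    finally have "card (T F E) \<le> card ((P <#>\<^bsub>X\<^esub> T F C) <#>\<^bsub>X\<^esub> T (F - ?U) E)"
      by (intro card_mono finite_set_mult fin TFU)
    also have "\<dots> \<le> card (P <#>\<^bsub>X\<^esub> T F C) * card (T (F - ?U) E)"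
      by (rule card_set_mult_le[OF fin TFU(1)])
    also have "\<dots> \<le> (card P * card (T F C)) * card E ^ card (F - ?U)"
      by (intro mult_mono card_set_mult_le P TFC TFU) auto
    also have "\<dots> \<le> ((\<Prod>i<n. card (A i) ^ card (D i)) * card (T F C)) * card E ^ card (F - ?U)"
      by (intro mult_mono P order_refl) auto
    finally have le: "card (T F E) \<le>
        ((\<Prod>i<n. card (A i) ^ card (D i)) * card (T F C)) * card E ^ card (F - ?U)" .
    have prod: "(\<Prod>i<n. real (card (A i)) ^ card (D i)) > 0"
      using A0 by (intro prod_pos) auto
    have "real (card (T F E)) \<le>
        ((\<Prod>i<n. real (card (A i)) ^ card (D i)) * card (T F C)) * real (card E) ^ card (F - ?U)"
      using le by (simp flip: of_nat_prod of_nat_power of_nat_mult)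
    then have "ln (card (T F E)) \<le>
        ln (((\<Prod>i<n. real (card (A i)) ^ card (D i)) * card (T F C)) * real (card E) ^ card (F - ?U))"
      using card_trajectory_pos[OF F E] by (intro ln_mono) auto
    also have "\<dots> = ln (\<Prod>i<n. real (card (A i)) ^ card (D i)) + ln (card (T F C)) + card (F - ?U) * ln (card E)"
      using prod TFC(2) cE by (simp add: ln_mult_pos ln_realpow)
    also have "ln (\<Prod>i<n. real (card (A i)) ^ card (D i)) = (\<Sum>i<n. card (D i) * ln (card (A i)))"
      using A0 by (subst ln_prod) (auto simp: ln_realpow)
    also have "\<dots> \<le> (\<Sum>i<n. card (D i) * (a * card (K i)))"
      using AB by (intro sum_mono mult_left_mono) auto
    also have "\<dots> = a * (\<Sum>i<n. real (card (D i) * card (K i)))"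
      by (simp add: sum_distrib_left mult_ac)
    \<comment> \<open>Near-disjointness bounds the total size of the tiles, and
      \<open>0 \<le> a\<close> keeps the direction of the inequality.\<close>
    also have "\<dots> \<le> a * (card F / (1 - e))"
    proof (intro mult_left_mono a)
      have "(1 - e) * (\<Sum>i<n. real (card (D i) * card (K i))) \<le> card F"
        using U' card_mono[OF F(1) U] by linarith
      then show "(\<Sum>i<n. real (card (D i) * card (K i))) \<le> card F / (1 - e)"
        using e by (simp add: field_simps)
    qed
    also have "card (F - ?U) * ln (card E) \<le> e * card F * ln (card E)"
      using rest lE by (rule mult_right_mono)
    finally show ?case by (simp add: algebra_simps)
  qed
  then show ?thesis using C by blast
qed

lemma card_trajectory_one: "F \<subseteq> carrier S \<Longrightarrow> finite F \<Longrightarrow> card (T F {\<one>\<^bsub>X\<^esub>}) = 1"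
  using finite_trajectory(2)[of F "{\<one>\<^bsub>X\<^esub>}"] card_trajectory_pos[of F "{\<one>\<^bsub>X\<^esub>}"] by simp

text \<open>A value that bounds the growth rate frequently can serve as the rate on tiles, and
  \<open>trajectory_growth\<close> for the trivial subgroup then makes it an eventual bound up to a
  small error. So the lower limit is a limit.\<close>

lemma entropy_limit_exists:
  assumes amen: "right_amenable S" and E: "finite E" "E \<subseteq> carrier X" "\<one>\<^bsub>X\<^esub> \<in> E"
  shows "\<exists>L\<ge>0. ((\<lambda>F. ln (card (T F E)) / card F) \<longlongrightarrow> L) S.folner_filter"
proof -
  \<comment> \<open>The infimum of these frequent upper bounds is the lower limit of the growth
    rate.\<close>
  define R where "R = {a :: real. a \<ge> 0 \<and> frequently (\<lambda>F. ln (card (T F E)) \<le> a * card F) S.folner_filter}"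
  have nbot: "S.folner_filter \<noteq> bot" by (rule S.folner_filter_not_bot[OF amen])
  have ln_nonneg: "0 \<le> ln (card (T F E))" if "finite F" "F \<subseteq> carrier S" for F
    using card_trajectory_pos[OF that E] by simp
  have cE: "card E > 0" using E by (auto simp: card_gt_0_iff)
  have "eventually (\<lambda>F. ln (card (T F E)) \<le> ln (card E) * card F) S.folner_filter"
    using S.eventually_finite_folner_filter
  proof eventually_elim
    case (elim F)
    then have "ln (card (T F E)) \<le> ln (real (card E) ^ card F)"
      using finite_trajectory(2)[of F E] card_trajectory_pos[of F E] E
      by (intro ln_mono) (auto simp flip: of_nat_power)
    then show ?case using cE by (simp add: ln_realpow mult.commute)
  qed
  then have "ln (real (card E)) \<in> R"
    unfolding R_def using eventually_frequently[OF nbot] cE by auto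
  then have ne: "R \<noteq> {}" by blast
  have bdd: "bdd_below R" unfolding R_def by (rule bdd_belowI[of _ 0]) auto
  have "Inf R \<ge> 0" using ne unfolding R_def by (intro cInf_greatest) auto
  moreover have "((\<lambda>F. ln (card (T F E)) / card F) \<longlongrightarrow> Inf R) S.folner_filter"
  proof (rule order_tendstoI)
    fix b assume b: "b < Inf R"
    show "eventually (\<lambda>F. b < ln (card (T F E)) / card F) S.folner_filter"
    \<comment> \<open>Membership in \<open>R\<close> includes nonnegativity, so a negative
      \<open>b\<close> says nothing through \<open>R\<close>; there the rate itself is
      nonnegative.\<close>
    proof (cases "b < 0")
      case True
      show ?thesis using S.eventually_finite_folner_filter
      proof eventually_elim
        case (elim F)
        then have "0 \<le> ln (card (T F E)) / card F" using ln_nonneg[of F] by simp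
        then show ?case using True by linarith
      qed
    next
      case False
      have "b \<notin> R" using b bdd cInf_lower by fastforce
      then have "eventually (\<lambda>F. \<not> ln (card (T F E)) \<le> b * card F) S.folner_filter"
        using False unfolding R_def frequently_def by simp
      with S.eventually_finite_folner_filter show ?thesis
        by eventually_elim (auto simp: field_simps card_gt_0_iff)
    qed
  next
    fix b assume "Inf R < b"
    then obtain a where a: "a \<in> R" "a < b" using cInf_lessD[OF ne] by blast
    obtain e where e: "0 < e" "e \<le> 1 / 2" "a / (1 - e) + e * ln (card E) < b"
      using small_correction[OF a(2)] by blast
    have "\<exists>C. finite C \<and> C \<subseteq> {\<one>\<^bsub>X\<^esub>} \<and> \<one>\<^bsub>X\<^esub> \<in> C \<and>
      eventually (\<lambda>F. ln (card (T F E)) \<le> (a / (1 - e) + e * ln (card E)) * card F + ln (card (T F C)))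
        S.folner_filter"
    \<comment> \<open>Each tile is covered by its own trajectory. The set \<open>C\<close> is forced
      to be trivial, so its term vanishes from the growth bound.\<close>
    proof (rule trajectory_growth[OF E X.triv_subgroup, where \<K> = "{K. ln (card (T K E)) \<le> a * card K}"])
      fix K assume K: "K \<in> {K. ln (card (T K E)) \<le> a * card K}" "finite K" "K \<subseteq> carrier S"
      then show "\<exists>A B. finite A \<and> A \<subseteq> carrier X \<and> ln (card A) \<le> a * card K \<and>
        finite B \<and> B \<subseteq> {\<one>\<^bsub>X\<^esub>} \<and> \<one>\<^bsub>X\<^esub> \<in> B \<and> T K E \<subseteq> A <#>\<^bsub>X\<^esub> B"
        using finite_trajectory[OF K(2,3) E(1,2)] trajectory_closed[OF K(3) E(2)]
          subset_set_mult_left[of "{\<one>\<^bsub>X\<^esub>}" "T K E"]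
        by (intro exI[of _ "T K E"] exI[of _ "{\<one>\<^bsub>X\<^esub>}"]) simp
    qed (use a e in \<open>simp_all add: R_def\<close>)
    then obtain C where C: "C \<subseteq> {\<one>\<^bsub>X\<^esub>}" "\<one>\<^bsub>X\<^esub> \<in> C" and growth:
      "eventually (\<lambda>F. ln (card (T F E)) \<le> (a / (1 - e) + e * ln (card E)) * card F + ln (card (T F C)))
        S.folner_filter"
      by (elim exE conjE) (rule that)
    from growth show "eventually (\<lambda>F. ln (card (T F E)) / card F < b) S.folner_filter"
      using S.eventually_finite_folner_filter
    proof eventually_elim
      case (elim F)
      have "C = {\<one>\<^bsub>X\<^esub>}" using C by blast
      then have "ln (card (T F E)) \<le> (a / (1 - e) + e * ln (card E)) * card F"
        using elim card_trajectory_one[of F] by simp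
      also have "\<dots> < b * card F"
        using e elim by (intro mult_strict_right_mono) (auto simp: card_gt_0_iff)
      finally show ?case using elim by (simp add: field_simps card_gt_0_iff)
    qed
  qed
  ultimately show ?thesis by blast
qed

text \<open>The limit along \<open>folner_filter\<close> is a limit along every net quantified over
  in \<open>H_alg_def\<close>; amenability supplies at least one net, which makes the described
  number unique.\<close>

lemma H_alg_limit:
  assumes amen: "right_amenable S" and E: "finite E" "E \<subseteq> carrier X" "\<one>\<^bsub>X\<^esub> \<in> E"
  shows "((\<lambda>F. ln (card (T F E)) / card F) \<longlongrightarrow> H_alg S X lam E) S.folner_filter"
    and "0 \<le> H_alg S X lam E"
proof -
  obtain L where L: "L \<ge> 0" "((\<lambda>F. ln (card (T F E)) / card F) \<longlongrightarrow> L) S.folner_filter"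
    using entropy_limit_exists[OF assms] by blast
  have net: "((\<lambda>i. ln (card (T (F i) E)) / card (F i)) \<longlongrightarrow> L) (net_filter I leq)"
    if "right_folner_net S I leq F" for I :: "'s net_index set" and leq F
    by (rule filterlim_compose[OF L(2) S.folner_net_tendsto_folner_filter[OF that]])
  obtain I :: "'s net_index set" and leq F where F: "right_folner_net S I leq F"
    using amen unfolding right_amenable_def by blast
  have nbot: "net_filter I leq \<noteq> bot"
    using F unfolding right_folner_net_def by (intro net_filter_not_bot) simp
  have "H_alg S X lam E = L"
    unfolding H_alg_def
  proof (rule the_equality)
    fix L' assume "\<forall>(I :: 's net_index set) leq F. right_folner_net S I leq F \<longrightarrow>
        ((\<lambda>i. ln (real (card (T (F i) E))) / real (card (F i))) \<longlongrightarrow> L') (net_filter I leq)"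
    then show "L' = L" using tendsto_unique[OF nbot] net[OF F] F by blast
  qed (use net in blast)
  then show "((\<lambda>F. ln (card (T F E)) / card F) \<longlongrightarrow> H_alg S X lam E) S.folner_filter"
    "0 \<le> H_alg S X lam E" using L by simp_all
qed

lemma H_alg_le_h_alg:
  assumes "finite E" "E \<subseteq> carrier X" "\<one>\<^bsub>X\<^esub> \<in> E"
  shows "ereal (H_alg S X lam E) \<le> h_alg S X lam"
  unfolding h_alg_def using assms by (intro SUP_upper) auto

end

section \<open>Subgroups and quotients\<close>

text \<open>With a representative \<open>r q\<close> in \<open>B\<close> for each class
  \<open>q\<close>, the map from \<open>(a, q)\<close> to \<open>a \<otimes> r q\<close> is
  injective: the class of the value is \<open>q\<close> because \<open>a\<close> is in
  \<open>Y\<close>, and cancelling \<open>r q\<close> recovers \<open>a\<close>.\<close>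

lemma (in comm_group) card_quotient_mult_le_card_set_mult:
  assumes Y: "subgroup Y G" and A: "finite A" "A \<subseteq> Y" and B: "finite B" "B \<subseteq> carrier G"
  shows "card A * card ((\<lambda>x. Y #> x) ` B) \<le> card (A <#> B)"
proof -
  define r where "r q = (SOME x. x \<in> B \<and> Y #> x = q)" for q
  have r: "r q \<in> B \<and> Y #> r q = q" if "q \<in> (\<lambda>x. Y #> x) ` B" for q
    unfolding r_def by (rule someI_ex) (use that in blast)
  have Yc: "Y \<subseteq> carrier G" using Y by (rule subgroup.subset)
  have coset: "Y #> (a \<otimes> r q) = q" if "a \<in> A" "q \<in> (\<lambda>x. Y #> x) ` B" for a q
  proof -
    have a: "a \<in> Y" "a \<in> carrier G" and rq: "r q \<in> carrier G" using that A(2) Yc B(2) r by blast+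
    have "Y #> (a \<otimes> r q) = (Y #> a) #> r q" using coset_mult_assoc[OF Yc a(2) rq] by simp
    also have "\<dots> = q" using coset_join2[OF a(2) Y a(1)] r that by simp
    finally show ?thesis .
  qed
  have "card (A \<times> ((\<lambda>x. Y #> x) ` B)) \<le> card (A <#> B)"
  proof (rule card_inj_on_le)
    show "inj_on (\<lambda>(a, q). a \<otimes> r q) (A \<times> ((\<lambda>x. Y #> x) ` B))"
    proof (rule inj_onI)
      fix p p' assume p: "p \<in> A \<times> ((\<lambda>x. Y #> x) ` B)" "p' \<in> A \<times> ((\<lambda>x. Y #> x) ` B)"
        and eq: "(case p of (a, q) \<Rightarrow> a \<otimes> r q) = (case p' of (a, q) \<Rightarrow> a \<otimes> r q)"
      obtain a q a' q' where pq: "p = (a, q)" "p' = (a', q')" by (cases p, cases p') (rule that)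
      have *: "a \<in> A" "q \<in> (\<lambda>x. Y #> x) ` B" "a' \<in> A" "q' \<in> (\<lambda>x. Y #> x) ` B"
        using p unfolding pq by blast+
      have eq': "a \<otimes> r q = a' \<otimes> r q'" using eq unfolding pq by simp
      have qq: "q = q'" using coset[OF *(1,2)] coset[OF *(3,4)] eq' by simp
      moreover have "a \<in> carrier G" "a' \<in> carrier G" "r q \<in> carrier G"
        using * A(2) Yc B(2) r[OF *(2)] by blast+
      ultimately show "p = p'" using eq' unfolding pq by simp
    qed
    show "(\<lambda>(a, q). a \<otimes> r q) ` (A \<times> ((\<lambda>x. Y #> x) ` B)) \<subseteq> A <#> B"
      using r unfolding set_mult_def by auto
  qed (rule finite_set_mult[OF A(1) B(1)])
  then show ?thesis by (simp add: card_cartesian_product)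
qed

text \<open>\<open>A\<close> picks one representative from each class met by \<open>B\<close>, and
  \<open>D\<close> collects the quotients of the points of \<open>B\<close> by their
  representatives, which lie in \<open>Y\<close>.\<close>

lemma (in comm_group) section_cover:
  assumes Y: "subgroup Y G" and B: "finite B" "B \<subseteq> carrier G"
  obtains A D where "finite A" "A \<subseteq> carrier G" "card A \<le> card ((\<lambda>x. Y #> x) ` B)"
    "finite D" "D \<subseteq> Y" "\<one> \<in> D" "B \<subseteq> A <#> D"
proof -
  define r where "r q = (SOME x. x \<in> B \<and> Y #> x = q)" for q
  have r: "r (Y #> x) \<in> B \<and> Y #> r (Y #> x) = Y #> x" if "x \<in> B" for x
    unfolding r_def by (rule someI_ex) (use that in blast)
  have Yc: "Y \<subseteq> carrier G" using Y by (rule subgroup.subset)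
  define A where "A = r ` (\<lambda>x. Y #> x) ` B"
  define D where "D = insert \<one> ((\<lambda>x. x \<otimes> inv (r (Y #> x))) ` B)"
  have A: "A \<subseteq> carrier G" using r B(2) unfolding A_def by blast
  have "x \<otimes> inv (r (Y #> x)) \<in> Y" if x: "x \<in> B" for x
  proof -
    have c: "x \<in> carrier G" "r (Y #> x) \<in> carrier G" using x r B(2) by blast+
    have "Y #> (x \<otimes> inv (r (Y #> x))) = Y"
      using coset_mult_inv2[OF _ c Yc] r[OF x] by simp
    then show ?thesis using coset_join1[OF _ _ Y] c by simp
  qed
  then have D: "D \<subseteq> Y" unfolding D_def using subgroup.one_closed[OF Y] by blast
  have "B \<subseteq> A <#> D"
  proof
    fix x assume x: "x \<in> B"
    have c: "x \<in> carrier G" "r (Y #> x) \<in> carrier G" using x r B(2) by blast+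
    have "x = r (Y #> x) \<otimes> (x \<otimes> inv (r (Y #> x)))"
      using c by (simp add: m_lcomm)
    moreover have "r (Y #> x) \<in> A" "x \<otimes> inv (r (Y #> x)) \<in> D" using x unfolding A_def D_def by blast+
    ultimately show "x \<in> A <#> D" unfolding set_mult_def by blast
  qed
  then show ?thesis
    using that[of A D] A D B(1) card_image_le[of "(\<lambda>x. Y #> x) ` B" r]
    unfolding A_def D_def by simp
qed

section \<open>The induced actions and the two entropy estimates for one finite set\<close>

context monoid_action
begin

lemma sub_monoid_action:
  assumes Y: "invariant_subgroup S X lam Y"
  shows "monoid_action S (X\<lparr>carrier := Y\<rparr>) (sub_action lam Y)"
proof -
  have sub: "subgroup Y X" and inv: "\<And>s y. s \<in> carrier S \<Longrightarrow> y \<in> Y \<Longrightarrow> lam s y \<in> Y"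
    using Y unfolding invariant_subgroup_def by auto
  have Yc: "y \<in> carrier X" if "y \<in> Y" for y using sub that by (rule subgroup.mem_carrier)
  have mult: "y \<otimes>\<^bsub>X\<^esub> z \<in> Y" if "y \<in> Y" "z \<in> Y" for y z using sub that by (rule subgroup.m_closed)
  have "comm_group (X\<lparr>carrier := Y\<rparr>)"
    by (rule group.group_comm_groupI[OF X.subgroup_imp_group[OF sub]]) (simp add: X.m_comm Yc)
  moreover have "left_action S (X\<lparr>carrier := Y\<rparr>) (sub_action lam Y)"
    unfolding left_action_def sub_action_def
    by (auto simp: hom_def inv mult lam_mult lam_compose lam_id Yc)
  ultimately show ?thesis
    by (intro monoid_action.intro monoid_action_axioms.intro S.monoid_cancel_axioms)
qed

lemma quotient_monoid_action:
  assumes Y: "invariant_subgroup S X lam Y"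
  shows "monoid_action S (X Mod Y) (quotient_action X lam Y)"
proof -
  have sub: "subgroup Y X" using Y unfolding invariant_subgroup_def by blast
  interpret Y: normal Y X by (rule X.subgroup_imp_normal[OF sub])
  have q: "quotient_action X lam Y s (Y #>\<^bsub>X\<^esub> x) = Y #>\<^bsub>X\<^esub> lam s x"
    if "s \<in> carrier S" "x \<in> carrier X" for s x
    using quotient_action_coset[OF X.comm_group_axioms action Y that] .
  have "left_action S (X Mod Y) (quotient_action X lam Y)"
    unfolding left_action_def hom_def carrier_FactGroup
    by (auto simp: q Y.rcos_sum lam_closed lam_mult lam_compose lam_id)
  then show ?thesis
    by (intro monoid_action.intro monoid_action_axioms.intro S.monoid_cancel_axioms
        X.abelian_FactGroup[OF sub])
qed

lemma sub_trajectory: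
  assumes Y: "invariant_subgroup S X lam Y" and F: "finite F" "F \<subseteq> carrier S" and E: "E \<subseteq> Y"
  shows "trajectory (X\<lparr>carrier := Y\<rparr>) (sub_action lam Y) F E = T F E"
proof -
  have "subgroup Y X" using Y unfolding invariant_subgroup_def by blast
  then have "(\<lambda>x. x) \<in> hom (X\<lparr>carrier := Y\<rparr>) X" using subgroup.subset by (fastforce simp: hom_def)
  then show ?thesis
    using trajectory_equivariant_hom[OF sub_monoid_action[OF Y] monoid_action_axioms _ _ F, of "\<lambda>x. x" E] E
    by (simp add: sub_action_def)
qed

lemma quotient_trajectory:
  assumes Y: "invariant_subgroup S X lam Y" and F: "finite F" "F \<subseteq> carrier S" and E: "E \<subseteq> carrier X"
  shows "trajectory (X Mod Y) (quotient_action X lam Y) F ((\<lambda>x. Y #>\<^bsub>X\<^esub> x) ` E) =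
    (\<lambda>x. Y #>\<^bsub>X\<^esub> x) ` T F E"
proof -
  have sub: "subgroup Y X" using Y unfolding invariant_subgroup_def by blast
  interpret Y: normal Y X by (rule X.subgroup_imp_normal[OF sub])
  show ?thesis
    by (rule trajectory_equivariant_hom[OF monoid_action_axioms quotient_monoid_action[OF Y] Y.r_coset_hom_Mod _ F E])
      (simp add: quotient_action_coset[OF X.comm_group_axioms action Y])
qed

text \<open>The trajectory of \<open>A <#> B\<close> is the product of those of \<open>A\<close> and
  \<open>B\<close>, and the former stays in \<open>Y\<close> by invariance. Counting cosets gives
  the inequality for every finite \<open>F\<close>, and the limits exist for all three
  terms.\<close>

lemma H_alg_superadditive:
  assumes amen: "right_amenable S" and Y: "invariant_subgroup S X lam Y"
    and A: "finite A" "A \<subseteq> Y" "\<one>\<^bsub>X\<^esub> \<in> A" and B: "finite B" "B \<subseteq> carrier X" "\<one>\<^bsub>X\<^esub> \<in> B"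
  shows "H_alg S (X\<lparr>carrier := Y\<rparr>) (sub_action lam Y) A +
    H_alg S (X Mod Y) (quotient_action X lam Y) ((\<lambda>x. Y #>\<^bsub>X\<^esub> x) ` B) \<le> H_alg S X lam (A <#>\<^bsub>X\<^esub> B)"
    (is "?HY + ?HQ \<le> _")
proof -
  interpret Y: monoid_action S "X\<lparr>carrier := Y\<rparr>" "sub_action lam Y" by (rule sub_monoid_action[OF Y])
  interpret Q: monoid_action S "X Mod Y" "quotient_action X lam Y" by (rule quotient_monoid_action[OF Y])
  have sub: "subgroup Y X" using Y unfolding invariant_subgroup_def by blast
  have Ac: "A \<subseteq> carrier X" using A(2) subgroup.subset[OF sub] by blast
  let ?pB = "(\<lambda>x. Y #>\<^bsub>X\<^esub> x) ` B"
  have "Y #>\<^bsub>X\<^esub> \<one>\<^bsub>X\<^esub> = Y" using X.coset_mult_one[OF subgroup.subset[OF sub]] .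
  then have pB: "finite ?pB" "?pB \<subseteq> carrier (X Mod Y)" "\<one>\<^bsub>X Mod Y\<^esub> \<in> ?pB"
    using B by (auto simp: carrier_FactGroup image_iff intro!: bexI[of _ "\<one>\<^bsub>X\<^esub>"])
  have AB: "finite (A <#>\<^bsub>X\<^esub> B)" "A <#>\<^bsub>X\<^esub> B \<subseteq> carrier X" "\<one>\<^bsub>X\<^esub> \<in> A <#>\<^bsub>X\<^esub> B"
    using finite_set_mult[OF A(1) B(1)] X.set_mult_closed[OF Ac B(2)] subset_set_mult_left[OF B(3) Ac] A(3)
    by auto
  have YA: "finite A" "A \<subseteq> carrier (X\<lparr>carrier := Y\<rparr>)" "\<one>\<^bsub>X\<lparr>carrier := Y\<rparr>\<^esub> \<in> A" using A by auto
  note limY = Y.H_alg_limit(1)[OF amen YA] and limQ = Q.H_alg_limit(1)[OF amen pB]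
  have "eventually (\<lambda>F. ln (card (Y.T F A)) / card F + ln (card (Q.T F ?pB)) / card F
      \<le> ln (card (T F (A <#>\<^bsub>X\<^esub> B))) / card F) S.folner_filter"
    using S.eventually_finite_folner_filter
  proof eventually_elim
    case (elim F)
    then have F: "finite F" "F \<subseteq> carrier S" by auto
    have "T F A \<subseteq> Y"
      using Y.trajectory_closed[OF F(2), of A] A(2) sub_trajectory[OF Y F A(2)] by simp
    then have "card (T F A) * card ((\<lambda>x. Y #>\<^bsub>X\<^esub> x) ` T F B) \<le> card (T F A <#>\<^bsub>X\<^esub> T F B)"
      by (intro X.card_quotient_mult_le_card_set_mult sub finite_trajectory trajectory_closed F A Ac B)
    then have "card (Y.T F A) * card (Q.T F ?pB) \<le> card (T F (A <#>\<^bsub>X\<^esub> B))"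
      using sub_trajectory[OF Y F A(2)] quotient_trajectory[OF Y F B(2)] trajectory_set_mult_right[OF F Ac B(2)]
      by simp
    moreover have pos: "card (Y.T F A) > 0" "card (Q.T F ?pB) > 0"
      using Y.card_trajectory_pos[OF F YA] Q.card_trajectory_pos[OF F pB] by auto
    ultimately have "ln (real (card (Y.T F A)) * real (card (Q.T F ?pB))) \<le> ln (card (T F (A <#>\<^bsub>X\<^esub> B)))"
      by (intro ln_mono) (auto simp flip: of_nat_mult)
    then show ?case using pos by (simp add: ln_mult_pos flip: add_divide_distrib) (rule divide_right_mono, auto)
  qed
  then show ?thesis
    by (rule tendsto_le[OF S.folner_filter_not_bot[OF amen] H_alg_limit(1)[OF amen AB] tendsto_add[OF limY limQ]])
qed

text \<open>Tiles are taken among the sets \<open>K\<close> whose trajectory has about the expected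
  number of classes modulo \<open>Y\<close>; \<open>section_cover\<close> splits these trajectories
  into representatives and a finite part in \<open>Y\<close>. The resulting \<open>C\<close> depends
  on \<open>b\<close> as well as on \<open>E\<close>.\<close>

lemma H_alg_subadditive:
  assumes amen: "right_amenable S" and Y: "invariant_subgroup S X lam Y"
    and E: "finite E" "E \<subseteq> carrier X" "\<one>\<^bsub>X\<^esub> \<in> E" and b: "b > 0"
  obtains C where "finite C" "C \<subseteq> Y" "\<one>\<^bsub>X\<^esub> \<in> C"
    "H_alg S X lam E \<le> H_alg S (X Mod Y) (quotient_action X lam Y) ((\<lambda>x. Y #>\<^bsub>X\<^esub> x) ` E) + b +
       H_alg S (X\<lparr>carrier := Y\<rparr>) (sub_action lam Y) C"
proof -
  interpret Y: monoid_action S "X\<lparr>carrier := Y\<rparr>" "sub_action lam Y" by (rule sub_monoid_action[OF Y])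
  interpret Q: monoid_action S "X Mod Y" "quotient_action X lam Y" by (rule quotient_monoid_action[OF Y])
  have sub: "subgroup Y X" using Y unfolding invariant_subgroup_def by blast
  let ?pE = "(\<lambda>x. Y #>\<^bsub>X\<^esub> x) ` E" and ?f = "S.folner_filter"
  define h where "h = H_alg S (X Mod Y) (quotient_action X lam Y) ?pE"
  have nbot: "?f \<noteq> bot" by (rule S.folner_filter_not_bot[OF amen])
  have "Y #>\<^bsub>X\<^esub> \<one>\<^bsub>X\<^esub> = Y" using X.coset_mult_one[OF subgroup.subset[OF sub]] .
  then have pE: "finite ?pE" "?pE \<subseteq> carrier (X Mod Y)" "\<one>\<^bsub>X Mod Y\<^esub> \<in> ?pE"
    using E by (auto simp: carrier_FactGroup image_iff intro!: bexI[of _ "\<one>\<^bsub>X\<^esub>"])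
  \<comment> \<open>Being above \<open>h\<close>, the rate \<open>a\<close> is attained by suitable
    tiles; being below \<open>h + b\<close>, it leaves room for the tiling errors.\<close>
  define a where "a = h + b / 2"
  have a: "0 \<le> a" "a < h + b" using Q.H_alg_limit(2)[OF amen pE] b unfolding a_def h_def by auto
  obtain e where e: "0 < e" "e \<le> 1 / 2" "a / (1 - e) + e * ln (card E) < h + b"
    using small_correction[OF a(2)] by blast
  have "eventually (\<lambda>K. ln (card (Q.T K ?pE)) / card K < a) ?f"
    using order_tendstoD(2)[OF Q.H_alg_limit(1)[OF amen pE], of a] b unfolding a_def h_def by simp
  then have "eventually (\<lambda>K. ln (card (Q.T K ?pE)) \<le> a * card K) ?f"
    using S.eventually_finite_folner_filter
    by eventually_elim (auto simp: field_simps card_gt_0_iff)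
  then have freq: "frequently (\<lambda>K. K \<in> {K. ln (card (Q.T K ?pE)) \<le> a * card K}) ?f"
    using eventually_frequently[OF nbot] by simp
  have "\<exists>C. finite C \<and> C \<subseteq> Y \<and> \<one>\<^bsub>X\<^esub> \<in> C \<and>
    eventually (\<lambda>F. ln (card (T F E)) \<le> (a / (1 - e) + e * ln (card E)) * card F + ln (card (T F C))) ?f"
  proof (rule trajectory_growth[OF E sub freq _ a(1) e(1,2)])
    fix K assume "K \<in> {K. ln (card (Q.T K ?pE)) \<le> a * card K}" and K: "finite K" "K \<subseteq> carrier S"
    then have le: "ln (card (Q.T K ?pE)) \<le> a * card K" by simp
    obtain A D where AD: "finite A" "A \<subseteq> carrier X" "card A \<le> card ((\<lambda>x. Y #>\<^bsub>X\<^esub> x) ` T K E)"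
      "finite D" "D \<subseteq> Y" "\<one>\<^bsub>X\<^esub> \<in> D" "T K E \<subseteq> A <#>\<^bsub>X\<^esub> D"
      by (rule X.section_cover[OF sub finite_trajectory(1)[OF K E(1,2)] trajectory_closed[OF K(2) E(2)]])
    have "A \<noteq> {}" using AD(7) one_in_trajectory[OF K(2) E(3)] by (auto simp: set_mult_def)
    then have "card A > 0" using AD(1) by (simp add: card_gt_0_iff)
    then have "ln (card A) \<le> ln (card (Q.T K ?pE))"
      using AD(3) quotient_trajectory[OF Y K E(2)] by (intro ln_mono) auto
    then have "ln (card A) \<le> a * card K" using le by linarith
    then show "\<exists>A B. finite A \<and> A \<subseteq> carrier X \<and> ln (card A) \<le> a * card K \<and>
        finite B \<and> B \<subseteq> Y \<and> \<one>\<^bsub>X\<^esub> \<in> B \<and> T K E \<subseteq> A <#>\<^bsub>X\<^esub> B"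
      using AD by blast
  qed
  then obtain C where C: "finite C" "C \<subseteq> Y" "\<one>\<^bsub>X\<^esub> \<in> C" and growth:
    "eventually (\<lambda>F. ln (card (T F E)) \<le> (a / (1 - e) + e * ln (card E)) * card F + ln (card (T F C))) ?f"
    by (elim exE conjE) (rule that)
  have YC: "finite C" "C \<subseteq> carrier (X\<lparr>carrier := Y\<rparr>)" "\<one>\<^bsub>X\<lparr>carrier := Y\<rparr>\<^esub> \<in> C" using C by auto
  have "eventually (\<lambda>F. ln (card (T F E)) / card F \<le>
      (a / (1 - e) + e * ln (card E)) + ln (card (Y.T F C)) / card F) ?f"
    using growth S.eventually_finite_folner_filter
  proof eventually_elim
    case (elim F)
    then have "real (card F) > 0" by (simp add: card_gt_0_iff)
    then show ?case using elim sub_trajectory[OF Y _ _ C(2), of F] by (simp add: field_simps)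
  qed
  then have "H_alg S X lam E \<le> (a / (1 - e) + e * ln (card E)) + H_alg S (X\<lparr>carrier := Y\<rparr>) (sub_action lam Y) C"
    by (rule tendsto_le[OF nbot tendsto_add[OF tendsto_const Y.H_alg_limit(1)[OF amen YC]] H_alg_limit(1)[OF amen E]])
  then show ?thesis using e(3) that[OF C] unfolding h_def by linarith
qed

end

section \<open>Passing from finite sets to suprema\<close>

theorem mainTheorem3:
  fixes S :: "('s, 'm) monoid_scheme"
    and X :: "('a, 'b) monoid_scheme"
    and lam :: "'s \<Rightarrow> 'a \<Rightarrow> 'a"
    and Y :: "'a set"
  assumes "monoid_cancel S"
    and "right_amenable S"
    and "comm_group X"
    and "left_action S X lam"
    and "invariant_subgroup S X lam Y"
  shows "h_alg S X lam =
    h_alg S (X\<lparr>carrier := Y\<rparr>) (sub_action lam Y) + h_alg S (X Mod Y) (quotient_action X lam Y)"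
proof (rule antisym)
  note amen = assms(2) and Y = assms(5)
  interpret X: monoid_action S X lam
    using assms(1,3,4) by (intro monoid_action.intro monoid_action_axioms.intro)
  interpret Y: monoid_action S "X\<lparr>carrier := Y\<rparr>" "sub_action lam Y" by (rule X.sub_monoid_action[OF Y])
  interpret Q: monoid_action S "X Mod Y" "quotient_action X lam Y" by (rule X.quotient_monoid_action[OF Y])
  have sub: "subgroup Y X" using Y unfolding invariant_subgroup_def by blast
  let ?hY = "h_alg S (X\<lparr>carrier := Y\<rparr>) (sub_action lam Y)" and ?hQ = "h_alg S (X Mod Y) (quotient_action X lam Y)"
  have Y1: "Y #>\<^bsub>X\<^esub> \<one>\<^bsub>X\<^esub> = Y" using X.X.coset_mult_one[OF subgroup.subset[OF sub]] .
  show "h_alg S X lam \<le> ?hY + ?hQ"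
    unfolding h_alg_def[of S X lam]
  proof (rule SUP_least)
    fix E assume "E \<in> {E. finite E \<and> E \<subseteq> carrier X \<and> \<one>\<^bsub>X\<^esub> \<in> E}"
    then have E: "finite E" "E \<subseteq> carrier X" "\<one>\<^bsub>X\<^esub> \<in> E" by auto
    let ?pE = "(\<lambda>x. Y #>\<^bsub>X\<^esub> x) ` E"
    have pE: "finite ?pE" "?pE \<subseteq> carrier (X Mod Y)" "\<one>\<^bsub>X Mod Y\<^esub> \<in> ?pE"
      using E Y1 by (auto simp: carrier_FactGroup image_iff intro!: bexI[of _ "\<one>\<^bsub>X\<^esub>"])
    show "ereal (H_alg S X lam E) \<le> ?hY + ?hQ"
    \<comment> \<open>The set \<open>C\<close> varies with \<open>b\<close>, so it is first absorbed
      into the supremum \<open>?hY\<close>, and only then does \<open>b\<close> tend to 0.\<close>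
    proof (rule ereal_le_epsilon2)
      fix b :: real assume "b > 0"
      then obtain C where C: "finite C" "C \<subseteq> Y" "\<one>\<^bsub>X\<^esub> \<in> C" and
        le: "H_alg S X lam E \<le> H_alg S (X Mod Y) (quotient_action X lam Y) ?pE + b +
          H_alg S (X\<lparr>carrier := Y\<rparr>) (sub_action lam Y) C"
        by (rule X.H_alg_subadditive[OF amen Y E])
      have "ereal (H_alg S X lam E) \<le> ereal (H_alg S (X\<lparr>carrier := Y\<rparr>) (sub_action lam Y) C) +
          ereal (H_alg S (X Mod Y) (quotient_action X lam Y) ?pE) + ereal b"
        using le by simp
      also have "\<dots> \<le> ?hY + ?hQ + ereal b"
        using C by (intro add_mono order_refl Y.H_alg_le_h_alg Q.H_alg_le_h_alg pE) auto
      finally show "ereal (H_alg S X lam E) \<le> ?hY + ?hQ + ereal b" .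
    qed
  qed
  \<comment> \<open>Excludes minus infinity, as required for moving \<open>?hQ\<close> under the
    supremum over subsets of \<open>Y\<close>.\<close>
  have nonneg: "0 \<le> ?hQ"
    using order_trans[OF _ Q.H_alg_le_h_alg[of "{\<one>\<^bsub>X Mod Y\<^esub>}"], of 0]
      Q.H_alg_limit(2)[OF amen, of "{\<one>\<^bsub>X Mod Y\<^esub>}"] Q.X.one_closed
    by auto
  show "?hY + ?hQ \<le> h_alg S X lam"
  proof -
    let ?IY = "{E. finite E \<and> E \<subseteq> carrier (X\<lparr>carrier := Y\<rparr>) \<and> \<one>\<^bsub>X\<lparr>carrier := Y\<rparr>\<^esub> \<in> E}"
    let ?IQ = "{E. finite E \<and> E \<subseteq> carrier (X Mod Y) \<and> \<one>\<^bsub>X Mod Y\<^esub> \<in> E}"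
    have neY: "?IY \<noteq> {}"
    proof
      assume "?IY = {}"
      moreover have "{\<one>\<^bsub>X\<lparr>carrier := Y\<rparr>\<^esub>} \<in> ?IY" using Y.X.one_closed by simp
      ultimately show False by (simp only: empty_iff)
    qed
    have neQ: "?IQ \<noteq> {}"
    proof
      assume "?IQ = {}"
      moreover have "{\<one>\<^bsub>X Mod Y\<^esub>} \<in> ?IQ" using Q.X.one_closed by simp
      ultimately show False by (simp only: empty_iff)
    qed
    have le: "ereal (H_alg S (X\<lparr>carrier := Y\<rparr>) (sub_action lam Y) A) +
        ereal (H_alg S (X Mod Y) (quotient_action X lam Y) D) \<le> h_alg S X lam"
      if A: "A \<in> ?IY" and D: "D \<in> ?IQ" for A D
    proof -
      have "D \<subseteq> (\<lambda>x. Y #>\<^bsub>X\<^esub> x) ` carrier X" "finite D" using D by (auto simp: carrier_FactGroup)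
      then obtain B0 where B0: "B0 \<subseteq> carrier X" "finite B0" "D = (\<lambda>x. Y #>\<^bsub>X\<^esub> x) ` B0"
        by (meson finite_subset_image)
      \<comment> \<open>The lift of \<open>D\<close> must contain the unit. Adding it does not
        change the image, because its coset \<open>Y\<close> is the unit of the quotient and already
        belongs to \<open>D\<close>.\<close>
      define B where "B = insert \<one>\<^bsub>X\<^esub> B0"
      have B: "finite B" "B \<subseteq> carrier X" "\<one>\<^bsub>X\<^esub> \<in> B" using B0 unfolding B_def by auto
      have DB: "D = (\<lambda>x. Y #>\<^bsub>X\<^esub> x) ` B" using B0(3) D Y1 unfolding B_def by auto
      have A': "finite A" "A \<subseteq> Y" "\<one>\<^bsub>X\<^esub> \<in> A" using A by auto
      have Ac: "A \<subseteq> carrier X" using A'(2) subgroup.subset[OF sub] by blast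
      have "ereal (H_alg S (X\<lparr>carrier := Y\<rparr>) (sub_action lam Y) A) +
        ereal (H_alg S (X Mod Y) (quotient_action X lam Y) D) \<le> ereal (H_alg S X lam (A <#>\<^bsub>X\<^esub> B))"
        using X.H_alg_superadditive[OF amen Y A' B] DB by simp
      also have "\<dots> \<le> h_alg S X lam"
        using X.subset_set_mult_left[OF B(3) Ac] A'(3)
        by (intro X.H_alg_le_h_alg finite_set_mult X.X.set_mult_closed A' Ac B) auto
      finally show ?thesis .
    qed
    have leQ: "ereal (H_alg S (X\<lparr>carrier := Y\<rparr>) (sub_action lam Y) A) + ?hQ \<le> h_alg S X lam" (is "?a + _ \<le> _")
      if A: "A \<in> ?IY" for A
    proof -
      have "?a + ?hQ = (SUP D\<in>?IQ. ?a + ereal (H_alg S (X Mod Y) (quotient_action X lam Y) D))"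
        unfolding h_alg_def[of S "X Mod Y"] by (rule SUP_ereal_add_right[OF neQ, symmetric]) simp
      also have "\<dots> \<le> h_alg S X lam" by (rule SUP_least) (rule le[OF A])
      finally show ?thesis .
    qed
    have "?hY + ?hQ = (SUP A\<in>?IY. ereal (H_alg S (X\<lparr>carrier := Y\<rparr>) (sub_action lam Y) A) + ?hQ)"
      unfolding h_alg_def[of S "X\<lparr>carrier := Y\<rparr>"]
      by (rule SUP_ereal_add_left[OF neY, symmetric]) (use nonneg in auto)
    also have "\<dots> \<le> h_alg S X lam" by (rule SUP_least) (rule leQ)
    finally show ?thesis .
  qed
qed

end
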